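(* Let $G$ be a compact (not necessarily connected) Abelian group with character group $X$, let $E\subset X$ be non-empty and $E^c:=X\setminus E$, let $(\Omega,\mu)$ be a measure space, $A:\Omega\to\mathrm{Aut}(G)$ a measurable map and $\Phi$ a locally $\mu$-integrable function on $\Omega$. Suppose that $(A(u)^* )^{-1}$ maps $E^c$ into $E^c$ for $\mu$-a.e. $u\in\Omega$. Let $1\le p\le\infty$. If $\Phi\in L^1(\mu)$, then the Hausdorff operator $\mathcal{H}_{\Phi,A}$ is bounded on $H^p_E(G)$, and in this case $$\|\mathcal{H}_{\Phi,A}\|_{\mathcal{L}(H^p_E(G))}\le\|\Phi\|_{L^1(\mu)}.$$
   Context: $G$ carries its normalized Haar measure $\nu$. $X$ is the (discrete) group of continuous characters of $G$, and $\widehat f(\chi)=\int_G f\overline{\chi}\,d\nu$ is the Fourier transform of $f\in L^1(G)$. $\mathrm{Aut}(G)$ is the group of topological automorphisms of $G$ with its natural topology. For $A\in\mathrm{Aut}(G)$ the dual automorphism $A^*\in\mathrm{Aut}(X)$ is $A^*(\chi)=\chi\circ A$. Generalized Hardy space, for non-empty $E\subset X$ and $1\le p\le\infty$: $H^p_E(G)=\{f\in L^p(G):\widehat f(\chi)=0\ \forall\chi\in E^c\}$, a closed subspace of $L^p(G)$ with the $L^p$ norm. Hausdorff operator: $(\mathcal{H}_{\Phi,A}f)(x)=\int_\Omega\Phi(u)f(A(u)(x))\,d\mu(u)$. That it is bounded on a normed space $Y$ of functions on $G$ means that for each $f\in Y$ the integral defines (for $\nu$-a.e. $x$) an element of $Y$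 and the resulting linear map $Y\to Y$ is bounded. $\mathcal{L}(Y)$ is the space of bounded linear operators on $Y$ with the operator norm.
   Formalization: "A measurable" is taken as Borel measurable and, on sets of finite measure, essentially countably approximable uniformly on G; this is automatic for metrizable G or if no real-valued measurable cardinals exist, and without it the claim can fail for non-metrizable G. *)

theory Defs
  imports "HOL-Probability.Essential_Supremum"
begin

definition normalized_haar :: "'g::topological_ab_group_add measure \<Rightarrow> bool" where
  "normalized_haar \<nu> \<longleftrightarrow>
     sets \<nu> = sets borel \<and>
     emeasure \<nu> UNIV = 1 \<and>
     (\<forall>a. \<forall>B\<in>sets borel. emeasure \<nu> ((+) a ` B) = emeasure \<nu> B) \<and>
     (\<forall>B\<in>sets borel. emeasure \<nu> B = (INF U\<in>{U. open U \<and> B \<subseteq> U}. emeasure \<nu> U)) \<and>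
     (\<forall>B\<in>sets borel. emeasure \<nu> B = (SUP K\<in>{K. compact K \<and> K \<subseteq> B}. emeasure \<nu> K))"

definition characters :: "('g::topological_ab_group_add \<Rightarrow> complex) set" where
  "characters = {\<gamma>. continuous_on UNIV \<gamma> \<and> (\<forall>x. norm (\<gamma> x) = 1) \<and>
                     (\<forall>x y. \<gamma> (x + y) = \<gamma> x * \<gamma> y)}"

definition fourier :: "'g::topological_ab_group_add measure \<Rightarrow> ('g \<Rightarrow> complex) \<Rightarrow> ('g \<Rightarrow> complex) \<Rightarrow> complex" where
  "fourier \<nu> f \<gamma> = (\<integral>x. f x * cnj (\<gamma> x) \<partial>\<nu>)"

definition top_automorphisms :: "('g::topological_ab_group_add \<Rightarrow> 'g) set" where
  "top_automorphisms = {T. bij T \<and> (\<forall>x y. T (x + y) = T x + T y) \<and>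
                           continuous_on UNIV T \<and> continuous_on UNIV (inv T)}"

text \<open>The natural (Braconnier) topology of the automorphism group: the coarsest topology
  refining the compact-open topology for which inversion is continuous.\<close>

definition aut_topology :: "('g::topological_ab_group_add \<Rightarrow> 'g) topology" where
  "aut_topology = topology_generated_by
     ({{T \<in> top_automorphisms. T ` K \<subseteq> U} | K U. compact K \<and> open U} \<union>
      {{T \<in> top_automorphisms. inv T ` K \<subseteq> U} | K U. compact K \<and> open U})"

definition aut_borel :: "('g::topological_ab_group_add \<Rightarrow> 'g) measure" where
  "aut_borel = sigma top_automorphisms {W. openin aut_topology W}"

text \<open>Strong (Bochner) measurability for the uniform structure of uniform convergence on the
  group: Borel measurability, and up to a null set countably many \<open>V\<close>-balls suffice,
  for each neighbourhood \<open>V\<close> of zero and on each set of finite measure.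
  The second condition is automatic for metrizable compact groups, where the automorphism
  group is second countable.  For larger groups plain Borel measurability alone need not make
  the integrand measurable in both variables.\<close>

definition aut_measurable :: "'w measure \<Rightarrow> ('w \<Rightarrow> 'g::topological_ab_group_add \<Rightarrow> 'g) \<Rightarrow> bool" where
  "aut_measurable M A \<longleftrightarrow>
     A \<in> M \<rightarrow>\<^sub>M aut_borel \<and>
     (\<forall>S\<in>sets M. \<forall>V. emeasure M S < \<infinity> \<longrightarrow> open V \<longrightarrow> 0 \<in> V \<longrightarrow>
        (\<exists>D. countable D \<and> D \<subseteq> top_automorphisms \<and>
             (AE u in M. u \<in> S \<longrightarrow> (\<exists>T\<in>D. \<forall>x. A u x - T x \<in> V))))"

definition dual_aut :: "('g \<Rightarrow> 'g) \<Rightarrow> ('g \<Rightarrow> complex) \<Rightarrow> ('g \<Rightarrow> complex)" where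
  "dual_aut T \<gamma> = \<gamma> \<circ> T"

definition locally_integrable :: "'w measure \<Rightarrow> ('w \<Rightarrow> complex) \<Rightarrow> bool" where
  "locally_integrable M \<Phi> \<longleftrightarrow>
     \<Phi> \<in> borel_measurable M \<and>
     (\<forall>S\<in>sets M. emeasure M S < \<infinity> \<longrightarrow> set_integrable M S \<Phi>)"

text \<open>Elements of \<open>L\<^sup>p\<close> are represented by functions; equality in \<open>L\<^sup>p\<close> is
  equality almost everywhere.\<close>

definition Lp_norm :: "'a measure \<Rightarrow> ennreal \<Rightarrow> ('a \<Rightarrow> complex) \<Rightarrow> real" where
  "Lp_norm \<nu> p f =
     (if p = \<infinity> then enn2real (esssup \<nu> (\<lambda>x. ennreal (norm (f x))))
      else (\<integral>x. norm (f x) powr enn2real p \<partial>\<nu>) powr (1 / enn2real p))"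

definition Lp_space :: "'a measure \<Rightarrow> ennreal \<Rightarrow> ('a \<Rightarrow> complex) set" where
  "Lp_space \<nu> p =
     {f \<in> borel_measurable \<nu>.
        if p = \<infinity> then esssup \<nu> (\<lambda>x. ennreal (norm (f x))) < \<infinity>
        else integrable \<nu> (\<lambda>x. norm (f x) powr enn2real p)}"

definition hardy_space ::
  "'g::topological_ab_group_add measure \<Rightarrow> ennreal \<Rightarrow> ('g \<Rightarrow> complex) set \<Rightarrow> ('g \<Rightarrow> complex) set" where
  "hardy_space \<nu> p E = {f \<in> Lp_space \<nu> p. \<forall>\<gamma> \<in> characters - E. fourier \<nu> f \<gamma> = 0}"

definition hausdorff_op ::
  "'w measure \<Rightarrow> ('w \<Rightarrow> complex) \<Rightarrow> ('w \<Rightarrow> 'g \<Rightarrow> 'g) \<Rightarrow> ('g \<Rightarrow> complex) \<Rightarrow> 'g \<Rightarrow> complex" where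
  "hausdorff_op M \<Phi> A f x = (\<integral>u. \<Phi> u * f (A u x) \<partial>M)"

text \<open>\<open>H\<close> induces a bounded linear operator on the space of almost-everywhere classes of
  members of \<open>Y\<close>, with norm \<open>N\<close>.  The value \<open>H f\<close> need only agree almost everywhere
  with a member of \<open>Y\<close>.\<close>

definition bounded_on ::
  "'g measure \<Rightarrow> ('g \<Rightarrow> complex) set \<Rightarrow> (('g \<Rightarrow> complex) \<Rightarrow> real) \<Rightarrow>
   (('g \<Rightarrow> complex) \<Rightarrow> 'g \<Rightarrow> complex) \<Rightarrow> bool" where
  "bounded_on \<nu> Y N H \<longleftrightarrow>
     (\<forall>f\<in>Y. \<exists>g\<in>Y. AE x in \<nu>. g x = H f x) \<and>
     (\<forall>f\<in>Y. \<forall>h\<in>Y. (AE x in \<nu>. f x = h x) \<longrightarrow> (AE x in \<nu>. H f x = H h x)) \<and>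
     (\<forall>f\<in>Y. \<forall>h\<in>Y. AE x in \<nu>. H (\<lambda>y. f y + h y) x = H f x + H h x) \<and>
     (\<forall>f\<in>Y. \<forall>c. AE x in \<nu>. H (\<lambda>y. c * f y) x = c * H f x) \<and>
     (\<exists>C. \<forall>f\<in>Y. \<forall>g\<in>Y. (AE x in \<nu>. g x = H f x) \<longrightarrow> N g \<le> C * N f)"

definition op_norm_on ::
  "'g measure \<Rightarrow> ('g \<Rightarrow> complex) set \<Rightarrow> (('g \<Rightarrow> complex) \<Rightarrow> real) \<Rightarrow>
   (('g \<Rightarrow> complex) \<Rightarrow> 'g \<Rightarrow> complex) \<Rightarrow> real" where
  "op_norm_on \<nu> Y N H =
     Inf {C. 0 \<le> C \<and> (\<forall>f\<in>Y. \<forall>g\<in>Y. (AE x in \<nu>. g x = H f x) \<longrightarrow> N g \<le> C * N f)}"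

text \<open>The Bochner integral is zero on non-integrable functions, so existence of the
  defining integral is a separate requirement.\<close>

definition hausdorff_bounded_on ::
  "'w measure \<Rightarrow> ('w \<Rightarrow> complex) \<Rightarrow> ('w \<Rightarrow> 'g \<Rightarrow> 'g) \<Rightarrow> 'g measure \<Rightarrow>
   ('g \<Rightarrow> complex) set \<Rightarrow> (('g \<Rightarrow> complex) \<Rightarrow> real) \<Rightarrow> bool" where
  "hausdorff_bounded_on M \<Phi> A \<nu> Y N \<longleftrightarrow>
     (\<forall>f\<in>Y. AE x in \<nu>. integrable M (\<lambda>u. \<Phi> u * f (A u x))) \<and>
     bounded_on \<nu> Y N (hausdorff_op M \<Phi> A)"

end

theory Submission
  imports Defs "HOL-Probability.Probability_Measure"
begin

text \<open>
  The integral triangle inequality explains the bound.  An automorphism \<open>T\<close> preserves \<open>\<nu>\<close>,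
  so \<open>f \<mapsto> f \<circ> T\<close> is an isometry of \<open>L\<^sup>p\<close>, and the Hausdorff operator is an average of
  such isometries with total weight the \<open>L\<^sup>1\<close> norm of \<open>\<Phi>\<close>.  The same invariance shows that
  the Fourier coefficient of \<open>f \<circ> T\<close> at \<open>\<gamma>\<close> is that of \<open>f\<close> at
  \<open>\<gamma> \<circ> inv T\<close>.  For \<open>T = A u\<close> this character stays outside \<open>E\<close> when \<open>\<gamma>\<close> is
  outside, so the coefficients of the average vanish off \<open>E\<close> whenever those of \<open>f\<close> do.

  Invariance (\<open>distr_top_automorphism\<close>) is the uniqueness of Haar measure.  The remaining work
  is to justify Fubini's theorem for \<open>(u, x) \<mapsto> f (A u x)\<close>.  If the group is not metrizable,
  this function need not be measurable for the product of the two sigma-algebras, even for Borel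
  \<open>f\<close>.  It is measurable for the completed product (\<open>joint_measurable\<close>), because an open set
  differs by a null set only from sets that are open for a pseudometrizable group topology
  (\<open>chain_open_sandwich\<close>), and for those countably many automorphisms suffice to approximate
  \<open>A\<close> (\<open>chain_open_measurable\<close>).

  Writing \<open>\<Phi> u = norm (\<Phi> u) * sgn (\<Phi> u)\<close> and absorbing the modulus into the measure gives a
  finite measure \<open>L\<close> with mass the norm of \<open>\<Phi>\<close> (\<open>random_automorphism_density\<close>).  For
  finite exponents the triangle inequality then takes the form of Jensen's inequality for
  \<open>L\<close> (\<open>integral_powr_Jensen\<close>) followed by Fubini's theorem.
\<close>

section \<open>Countable systems of neighbourhoods of zero\<close>

text \<open>A chain is a base at zero of a pseudometrizable group topology, coarser than the
  given one; \<open>chain_open V\<close> is openness in that topology.\<close>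

definition nbhd_chain :: "(nat \<Rightarrow> 'g::topological_ab_group_add set) \<Rightarrow> bool" where
  "nbhd_chain V \<longleftrightarrow> (\<forall>n. open (V n) \<and> 0 \<in> V n \<and> (\<forall>x\<in>V n. - x \<in> V n) \<and>
     (\<forall>x\<in>V (Suc n). \<forall>y\<in>V (Suc n). x + y \<in> V n))"

definition chain_open :: "(nat \<Rightarrow> 'g::topological_ab_group_add set) \<Rightarrow> 'g set \<Rightarrow> bool" where
  "chain_open V W \<longleftrightarrow> (\<forall>y\<in>W. \<exists>n. \<forall>v\<in>V n. y + v \<in> W)"

lemma nbhd_chainD:
  assumes "nbhd_chain V"
  shows "open (V n)" "0 \<in> V n" "x \<in> V n \<Longrightarrow> - x \<in> V n"
    "x \<in> V (Suc n) \<Longrightarrow> y \<in> V (Suc n) \<Longrightarrow> x + y \<in> V n"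
  using assms unfolding nbhd_chain_def by blast+

lemma nbhd_chain_antimono:
  assumes "nbhd_chain V" "m \<le> n"
  shows "V n \<subseteq> V m"
proof -
  have "V (Suc k) \<subseteq> V k" for k
    using nbhd_chainD(2,4)[OF assms(1)] by (metis add.right_neutral subsetI)
  then show ?thesis
    using lift_Suc_antimono_le[of V m n] assms(2) by blast
qed

lemma open_translate:
  fixes U :: "'g::topological_ab_group_add set"
  assumes "open U"
  shows "open {y. a + y \<in> U}"
  using open_vimage[OF assms, of "\<lambda>y. a + y"]
  by (simp add: continuous_intros vimage_def)

lemma nbhd_chain_closure:
  assumes V: "nbhd_chain V"
  shows "closure (V (Suc n)) \<subseteq> V n"
proof
  fix x assume x: "x \<in> closure (V (Suc n))"
  have "open {y. - x + y \<in> V (Suc n)}"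
    by (rule open_translate) (rule nbhd_chainD[OF V])
  moreover have "x \<in> {y. - x + y \<in> V (Suc n)}"
    using nbhd_chainD[OF V] by simp
  ultimately obtain y where y: "y \<in> V (Suc n)" "- x + y \<in> V (Suc n)"
    using x by (metis (no_types, lifting) closure_iff_nhds_not_empty disjoint_iff mem_Collect_eq order_refl)
  then have "y + - (- x + y) \<in> V n"
    using nbhd_chainD[OF V] by blast
  then show "x \<in> V n" by simp
qed

lemma zero_nbhd_halve:
  fixes N :: "'g::topological_ab_group_add set"
  assumes "open N" "0 \<in> N"
  obtains V where "open V" "0 \<in> V" "\<And>x. x \<in> V \<Longrightarrow> - x \<in> V"
    "\<And>x y. x \<in> V \<Longrightarrow> y \<in> V \<Longrightarrow> x + y \<in> N"
proof -
  have "open ((\<lambda>z. fst z + snd z) -` N)"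
    by (rule open_vimage[OF assms(1)]) (intro continuous_intros)
  moreover have "(0, 0) \<in> (\<lambda>z. fst z + snd z) -` N"
    using assms by simp
  ultimately obtain P Q where PQ: "open P" "open Q" "(0, 0) \<in> P \<times> Q"
    "P \<times> Q \<subseteq> (\<lambda>z. fst z + snd z) -` N"
    by (rule open_prod_elim)
  define R where "R = P \<inter> Q"
  have "open R" "0 \<in> R" using PQ by (auto simp: R_def)
  have cont: "continuous_on UNIV (uminus :: 'g \<Rightarrow> 'g)"
    unfolding continuous_on_def by (auto intro!: tendsto_intros)
  have "open (uminus -` R)"
    by (rule open_vimage[OF \<open>open R\<close> cont])
  show ?thesis
  proof (rule that[of "R \<inter> uminus -` R"])
    show "open (R \<inter> uminus -` R)" using \<open>open R\<close> \<open>open (uminus -` R)\<close> by blast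
    show "x + y \<in> N" if "x \<in> R \<inter> uminus -` R" "y \<in> R \<inter> uminus -` R" for x y
      using subsetD[OF PQ(4), of "(x, y)"] that by (simp add: R_def)
  qed (use \<open>0 \<in> R\<close> in auto)
qed

lemma nbhd_chain_exists:
  fixes N :: "nat \<Rightarrow> 'g::topological_ab_group_add set"
  assumes N: "\<And>n. open (N n)" "\<And>n. 0 \<in> N n"
  obtains V where "nbhd_chain V" "\<And>n. V n \<subseteq> N n"
proof -
  let ?P = "\<lambda>n V. open V \<and> 0 \<in> V \<and> (\<forall>x\<in>V. - x \<in> V) \<and> V \<subseteq> N n"
  have "\<exists>V. \<forall>n. ?P n (V n) \<and> (\<forall>x\<in>V (Suc n). \<forall>y\<in>V (Suc n). x + y \<in> V n)"
  proof (rule dependent_nat_choice)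
    obtain V where "open V" "0 \<in> V" "\<And>x. x \<in> V \<Longrightarrow> - x \<in> V"
      "\<And>x y. x \<in> V \<Longrightarrow> y \<in> V \<Longrightarrow> x + y \<in> N 0"
      using zero_nbhd_halve[OF N] by metis
    then show "\<exists>V. ?P 0 V"
      by (metis add.right_neutral subsetI)
  next
    fix V n assume "?P n V"
    then have "open (V \<inter> N (Suc n))" "0 \<in> V \<inter> N (Suc n)"
      using N by auto
    then obtain W where "open W" "0 \<in> W" "\<And>x. x \<in> W \<Longrightarrow> - x \<in> W"
      "\<And>x y. x \<in> W \<Longrightarrow> y \<in> W \<Longrightarrow> x + y \<in> V \<inter> N (Suc n)"
      using zero_nbhd_halve by metis
    note W = this
    have "W \<subseteq> N (Suc n)" using W(4)[OF _ W(2)] by auto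
    with W show "\<exists>W. ?P (Suc n) W \<and> (\<forall>x\<in>W. \<forall>y\<in>W. x + y \<in> V)"
      by (intro exI[of _ W] conjI ballI) simp_all
  qed
  then obtain V where V: "\<forall>n. ?P n (V n) \<and> (\<forall>x\<in>V (Suc n). \<forall>y\<in>V (Suc n). x + y \<in> V n)"
    by (rule exE)
  show ?thesis
    by (rule that[of V]) (use V in \<open>simp_all add: nbhd_chain_def\<close>)
qed

lemma compact_add_nbhd:
  fixes K U :: "'g::topological_ab_group_add set"
  assumes "compact K" "open U" "K \<subseteq> U"
  obtains V where "open V" "0 \<in> V" "\<And>k v. k \<in> K \<Longrightarrow> v \<in> V \<Longrightarrow> k + v \<in> U"
proof -
  have "open ((\<lambda>z. snd z + fst z) -` U)"
    by (rule open_vimage[OF assms(2)]) (intro continuous_intros)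
  moreover have "{0} \<times> K \<subseteq> (\<lambda>z. snd z + fst z) -` U"
    using assms(3) by auto
  ultimately have "\<exists>X. 0 \<in> X \<and> open X \<and> X \<times> K \<subseteq> (\<lambda>z. snd z + fst z) -` U"
    by (rule Elementary_Topology.tube_lemma[OF assms(1)])
  then obtain X where "0 \<in> X" "open X" "X \<times> K \<subseteq> (\<lambda>z. snd z + fst z) -` U"
    by (elim exE conjE)
  then show ?thesis by (intro that[of X]) auto
qed

text \<open>The saturation of an open set by the subgroup \<open>\<Inter>n. V n\<close> is open for the coarser group
  topology generated by the chain; compactness gives the required \<open>n\<close>, since the
  \<open>V n\<close> shrink to the subgroup.\<close>

lemma chain_open_saturation:
  fixes U :: "'g::topological_ab_group_add set"
  assumes cpt: "compact (UNIV :: 'g set)" and V: "nbhd_chain V" and U: "open U"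
  shows "chain_open V (\<Union>h\<in>(\<Inter>n. V n). {y. h + y \<in> U})" (is "chain_open V ?W")
  unfolding chain_open_def
proof (rule ballI, rule ccontr)
  let ?H = "\<Inter>n. V n"
  fix w assume "w \<in> ?W" and no: "\<not> (\<exists>n. \<forall>v\<in>V n. w + v \<in> ?W)"
  have W: "open ?W" by (intro open_UN ballI open_translate U)
  define F where "F n = closure (V n) \<inter> - {v. w + v \<in> ?W}" for n
  have "UNIV \<inter> (\<Inter>n\<in>UNIV. F n) \<noteq> {}"
  proof (rule compact_imp_fip_image[OF cpt])
    show "closed (F n)" for n
      unfolding F_def by (intro closed_Int closed_closure closed_Compl open_translate W)
    fix I :: "nat set" assume I: "finite I"
    obtain m where m: "\<And>i. i \<in> I \<Longrightarrow> i \<le> m"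
      using I finite_nat_set_iff_bounded_le by auto
    obtain v where v: "v \<in> V m" "w + v \<notin> ?W" using no by blast
    have "v \<in> F i" if "i \<in> I" for i
      using v nbhd_chain_antimono[OF V m[OF that]] closure_subset[of "V i"]
      unfolding F_def by blast
    then show "UNIV \<inter> (\<Inter>i\<in>I. F i) \<noteq> {}" by blast
  qed
  then obtain v where v: "\<And>n. v \<in> F n" by blast
  then have vH: "v \<in> ?H"
    using nbhd_chain_closure[OF V] unfolding F_def by blast
  obtain h where h: "h \<in> ?H" "h + w \<in> U"
    using \<open>w \<in> ?W\<close> by blast
  have "h + - v \<in> V n" for n
    using h(1) vH by (intro nbhd_chainD(3,4)[OF V]) auto
  then have "h + - v \<in> ?H" by blast
  moreover have "(h + - v) + (w + v) \<in> U" using h(2) by (simp add: algebra_simps)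
  ultimately have "w + v \<in> ?W" by (intro UN_I[of "h + - v"] CollectI)
  moreover have "w + v \<notin> ?W"
    using v[of 0] unfolding F_def by (simp only: Int_iff Compl_iff mem_Collect_eq not_False_eq_True)
  ultimately show False by contradiction
qed

section \<open>Haar measure\<close>

lemma top_automorphismD:
  assumes "T \<in> top_automorphisms"
  shows "bij T" "T (x + y) = T x + T y" "continuous_on UNIV T" "T \<in> borel_measurable borel"
  using assms unfolding top_automorphisms_def
  by (auto intro: borel_measurable_continuous_onI)

locale haar_group =
  fixes \<nu> :: "'g::{topological_ab_group_add, t2_space} measure"
  assumes compact_group: "compact (UNIV :: 'g set)"
    and haar: "normalized_haar \<nu>"

sublocale haar_group \<subseteq> prob_space \<nu>
proof
  show "emeasure \<nu> (space \<nu>) = 1"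
    using haar sets_eq_imp_space_eq[of \<nu> borel] unfolding normalized_haar_def by simp
qed

context haar_group
begin

lemma sets_haar [measurable_cong]: "sets \<nu> = sets borel"
  using haar unfolding normalized_haar_def by blast

lemma space_haar [simp]: "space \<nu> = UNIV"
  using sets_eq_imp_space_eq[OF sets_haar] by simp

lemma emeasure_translate: "B \<in> sets borel \<Longrightarrow> emeasure \<nu> ((+) a ` B) = emeasure \<nu> B"
  using haar unfolding normalized_haar_def by blast

lemma translate_eq: "(+) (- a) ` B = {y. a + y \<in> B}" for a :: 'g
proof -
  have "y \<in> (+) (- a) ` B" if "a + y \<in> B" for y
    using that by (intro image_eqI[of _ _ "a + y"]) auto
  then show ?thesis by auto
qed

lemma emeasure_preimage_translate:
  "B \<in> sets borel \<Longrightarrow> emeasure \<nu> {y. a + y \<in> B} = emeasure \<nu> B"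
  using emeasure_translate[of B "- a"] unfolding translate_eq by simp

lemma outer_regular: "B \<in> sets borel \<Longrightarrow>
    emeasure \<nu> B = (INF U\<in>{U. open U \<and> B \<subseteq> U}. emeasure \<nu> U)"
  using haar unfolding normalized_haar_def by blast

lemma inner_regular: "B \<in> sets borel \<Longrightarrow>
    emeasure \<nu> B = (SUP K\<in>{K. compact K \<and> K \<subseteq> B}. emeasure \<nu> K)"
  using haar unfolding normalized_haar_def by blast

text \<open>This is the uniqueness of Haar measure, in the form of an inequality on compact sets.
  Cut the group into countably many pieces \<open>P i\<close>, each within \<open>V\<close> of a
  point \<open>a i\<close>.  If \<open>x \<in> P i\<close> and \<open>x + y \<in> K\<close>, then
  \<open>a i + y\<close> lies in a small neighbourhood \<open>U\<close> of \<open>K\<close>, so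
  \<open>m K = m {x. x + y \<in> K} \<le> (\<Sum>i. m (P i) * indicator U (a i + y))\<close> for each \<open>y\<close>.
  Integrating over \<open>y\<close> gives \<open>m K \<le> \<nu> U\<close>.  Discretizing \<open>x\<close> avoids the
  joint measurability of addition, which can fail when the topology has no countable base.\<close>

lemma invariant_le_haar_compact:
  fixes m :: "'g measure"
  assumes sets_m: "sets m = sets borel" and m1: "emeasure m UNIV = 1"
    and inv: "\<And>a B. B \<in> sets borel \<Longrightarrow> emeasure m {x. a + x \<in> B} = emeasure m B"
    and K: "compact K"
  shows "emeasure m K \<le> emeasure \<nu> K"
proof -
  have "K \<in> sets borel" using K by (intro borel_closed compact_imp_closed)
  have "emeasure m K \<le> emeasure \<nu> U" if U: "open U" "K \<subseteq> U" for U
  proof -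
    obtain V0 where V0: "open V0" "0 \<in> V0" "\<And>k v. k \<in> K \<Longrightarrow> v \<in> V0 \<Longrightarrow> k + v \<in> U"
      using compact_add_nbhd[OF K U] by metis
    obtain V where V: "open V" "0 \<in> V" "\<And>x. x \<in> V \<Longrightarrow> - x \<in> V"
      "\<And>x y. x \<in> V \<Longrightarrow> y \<in> V \<Longrightarrow> x + y \<in> V0"
      using zero_nbhd_halve[OF V0(1,2)] by metis
    have "UNIV \<subseteq> (\<Union>a\<in>UNIV. {x. - a + x \<in> V})"
      using V(2) by (auto intro!: exI[of _ "_::'g"])
    then obtain F where F: "finite F" "UNIV \<subseteq> (\<Union>a\<in>F. {x. - a + x \<in> V})"
      using compactE_image[OF compact_group, of UNIV "\<lambda>a. {x. - a + x \<in> V}"]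
        open_translate[OF V(1)] by metis
    then have "F \<noteq> {}" by auto
    define a where "a = from_nat_into F"
    have ran: "range a = F"
      unfolding a_def by (rule range_from_nat_into[OF \<open>F \<noteq> {}\<close> countable_finite[OF F(1)]])
    define P where "P = disjointed (\<lambda>i. {x. - a i + x \<in> V})"
    have sP [measurable]: "P i \<in> sets borel" for i
    proof -
      have "range (\<lambda>i. {x. - a i + x \<in> V}) \<subseteq> sets borel"
        by (intro image_subsetI borel_open open_translate V(1))
      then show ?thesis
        unfolding P_def using sets.range_disjointed_sets by blast
    qed
    have Pun: "(\<Union>i. P i) = UNIV"
      unfolding P_def UN_disjointed_eq using F(2) ran by auto
    have PV: "- a i + x \<in> V" if "x \<in> P i" for i x
      using that disjointed_subset[of "\<lambda>i. {x. - a i + x \<in> V}" i] unfolding P_def by auto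
    have shift [measurable]: "{y. a i + y \<in> U} \<in> sets borel" for i
      using open_translate[OF U(1)] by (intro borel_open)
    have pw: "emeasure m K \<le> (\<Sum>i. emeasure m (P i) * indicator {y. a i + y \<in> U} y)" for y
    proof -
      have Ky: "{x. y + x \<in> K} \<in> sets borel"
        using measurable_sets[OF borel_measurable_continuous_onI[of "\<lambda>x. y + x"] \<open>K \<in> sets borel\<close>]
        by (simp add: vimage_def continuous_intros)
      have Py: "(if a i + y \<in> U then P i else {}) \<in> sets m" for i
        using sP sets_m by simp
      have "emeasure m K = emeasure m {x. y + x \<in> K}"
        using inv[OF \<open>K \<in> sets borel\<close>] by simp
      also have "\<dots> \<le> emeasure m (\<Union>i. if a i + y \<in> U then P i else {})"
      proof (rule emeasure_mono)
        show "{x. y + x \<in> K} \<subseteq> (\<Union>i. if a i + y \<in> U then P i else {})"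
        proof
          fix x assume x: "x \<in> {x. y + x \<in> K}"
          obtain i where i: "x \<in> P i" using Pun by blast
          have "- (- a i + x) \<in> V0"
            using V(3)[OF PV[OF i]] V(4)[OF _ V(2)] by fastforce
          then have "(y + x) + - (- a i + x) \<in> U"
            using V0(3) x by blast
          then have "a i + y \<in> U" by (simp add: algebra_simps)
          with i show "x \<in> (\<Union>i. if a i + y \<in> U then P i else {})" by auto
        qed
      qed (intro sets.countable_UN image_subsetI Py)
      also have "\<dots> \<le> (\<Sum>i. emeasure m (if a i + y \<in> U then P i else {}))"
        by (intro emeasure_subadditive_countably image_subsetI Py)
      also have "\<dots> = (\<Sum>i. emeasure m (P i) * indicator {y. a i + y \<in> U} y)"
        by (intro suminf_cong) auto
      finally show ?thesis .
    qed
    have "emeasure m K = (\<integral>\<^sup>+y. emeasure m K \<partial>\<nu>)"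
      using emeasure_space_1 by simp
    also have "\<dots> \<le> (\<integral>\<^sup>+y. (\<Sum>i. emeasure m (P i) * indicator {y. a i + y \<in> U} y) \<partial>\<nu>)"
      by (intro nn_integral_mono pw)
    also have "\<dots> = (\<Sum>i. \<integral>\<^sup>+y. emeasure m (P i) * indicator {y. a i + y \<in> U} y \<partial>\<nu>)"
      by (intro nn_integral_suminf) measurable
    also have "\<dots> = (\<Sum>i. emeasure m (P i) * emeasure \<nu> U)"
      using shift sets_haar emeasure_preimage_translate[OF borel_open[OF U(1)]]
      by (simp add: nn_integral_cmult_indicator)
    also have "\<dots> = (\<Sum>i. emeasure m (P i)) * emeasure \<nu> U"
      by simp
    also have "(\<Sum>i. emeasure m (P i)) = 1"
      using suminf_emeasure[of P m] sP sets_m Pun m1 disjoint_family_disjointed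
      unfolding P_def by fastforce
    finally show ?thesis by simp
  qed
  then show ?thesis
    unfolding outer_regular[OF \<open>K \<in> sets borel\<close>] by (auto intro: INF_greatest)
qed

text \<open>The image measure is again translation invariant, so it lies below \<open>\<nu>\<close> on compact
  sets.  Inner regularity extends this to Borel sets, and complements turn the inequality between
  probability measures into equality.\<close>

lemma distr_top_automorphism:
  assumes T: "T \<in> top_automorphisms"
  shows "distr \<nu> borel T = \<nu>"
proof -
  define m where "m = distr \<nu> borel T"
  note [measurable] = top_automorphismD(4)[OF T]
  have em: "emeasure m B = emeasure \<nu> (T -` B)" if "B \<in> sets borel" for B
    unfolding m_def using that by (subst emeasure_distr) auto
  have sm: "sets m = sets borel" by (simp add: m_def)
  have meas: "T -` B \<in> sets borel" if "B \<in> sets borel" for B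
    using measurable_sets[OF top_automorphismD(4)[OF T] that] by simp
  have m1: "emeasure m UNIV = 1" using em[of UNIV] emeasure_space_1 by simp
  have inv: "emeasure m {x. a + x \<in> B} = emeasure m B" if B: "B \<in> sets borel" for a B
  proof -
    obtain b where b: "a = T b" using top_automorphismD(1)[OF T] by (metis bij_pointE)
    have Ba: "{x. a + x \<in> B} \<in> sets borel"
      using measurable_sets[OF borel_measurable_continuous_onI[of "\<lambda>x. a + x"] B]
      by (simp add: vimage_def continuous_intros)
    have "T -` {x. a + x \<in> B} = {x. b + x \<in> T -` B}"
      using b top_automorphismD(2)[OF T] by auto
    then show ?thesis
      using em[OF Ba] em[OF B] emeasure_preimage_translate[OF meas[OF B]] by simp
  qed
  have le: "emeasure m B \<le> emeasure \<nu> B" if B: "B \<in> sets borel" for B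
    unfolding em[OF B] inner_regular[OF meas[OF B]]
  proof (rule SUP_least, clarify)
    fix K assume K: "compact K" "K \<subseteq> T -` B"
    have TK: "compact (T ` K)"
      using compact_continuous_image[OF continuous_on_subset[OF top_automorphismD(3)[OF T]] K(1)] by simp
    then have bTK: "T ` K \<in> sets borel" by (intro borel_closed compact_imp_closed)
    have "emeasure \<nu> K \<le> emeasure \<nu> (T -` (T ` K))"
      using meas[OF bTK] sets_haar by (intro emeasure_mono) auto
    also have "\<dots> \<le> emeasure \<nu> (T ` K)"
      using invariant_le_haar_compact[OF sm m1 inv TK] em[OF bTK] by simp
    also have "\<dots> \<le> emeasure \<nu> B"
      using K(2) B sets_haar by (intro emeasure_mono) auto
    finally show "emeasure \<nu> K \<le> emeasure \<nu> B" .
  qed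
  interpret m: prob_space m
    using m1 sets_eq_imp_space_eq[OF sm] by (intro prob_spaceI) simp
  have "m = \<nu>"
  proof (rule measure_eqI)
    show "sets m = sets \<nu>" using sm sets_haar by simp
    fix B assume "B \<in> sets m"
    then have B: "B \<in> sets borel" using sm by simp
    have le': "measure m C \<le> measure \<nu> C" if "C \<in> sets borel" for C
      using le[OF that] by (simp add: m.emeasure_eq_measure emeasure_eq_measure)
    have "measure m (- B) = 1 - measure m B" "measure \<nu> (- B) = 1 - measure \<nu> B"
      using m.prob_compl[of B] prob_compl[of B] B sm sets_haar sets_eq_imp_space_eq[OF sm]
      by (auto simp: Compl_eq_Diff_UNIV)
    then show "emeasure m B = emeasure \<nu> B"
      using le'[OF B] le'[of "- B"] B by (simp add: m.emeasure_eq_measure emeasure_eq_measure)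
  qed
  then show ?thesis by (simp add: m_def)
qed

text \<open>Haar measure does not distinguish an open set from suitable inner and outer sets that are
  open for a pseudometrizable group topology, as in the theorem of Kakutani and Kodaira.  From inside: exhaust \<open>U\<close> by
  compact sets \<open>K n\<close> and choose the chain with \<open>K n + V n \<subseteq> U\<close>; the inner set
  is the interior of \<open>U\<close> for the chain.  From outside: saturate \<open>U\<close> by
  \<open>H = (\<Inter>n. V n)\<close>.  The inner set is \<open>H\<close>-invariant, so each translate of
  \<open>U\<close> by an element of \<open>H\<close> exceeds it by a null set only, and inner regularity
  reduces the union over all of \<open>H\<close> to finite unions.\<close>

lemma chain_open_sandwich:
  assumes U: "open U"
  obtains V C W where "nbhd_chain V" "open C" "open W" "chain_open V C" "chain_open V W"
    "C \<subseteq> U" "U \<subseteq> W" "emeasure \<nu> W = emeasure \<nu> C"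
proof -
  have bU: "U \<in> sets borel" using U by simp
  have "emeasure \<nu> ` {K. compact K \<and> K \<subseteq> U} \<noteq> {}" by (auto intro!: exI[of _ "{}"])
  then obtain k :: "nat \<Rightarrow> ennreal" where k: "range k \<subseteq> emeasure \<nu> ` {K. compact K \<and> K \<subseteq> U}"
    "emeasure \<nu> U = (SUP i. k i)"
    using ennreal_Sup_countable_SUP inner_regular[OF bU] by metis
  have "\<forall>n. \<exists>K. compact K \<and> K \<subseteq> U \<and> k n = emeasure \<nu> K"
    using k(1) by (auto simp: image_subset_iff)
  then obtain K where K: "\<And>n. compact (K n)" "\<And>n. K n \<subseteq> U" "\<And>n. k n = emeasure \<nu> (K n)"
    by metis
  have "\<forall>n. \<exists>N. open N \<and> 0 \<in> N \<and> (\<forall>x\<in>K n. \<forall>v\<in>N. x + v \<in> U)"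
    using compact_add_nbhd[OF K(1) U K(2)] by metis
  then obtain N where N: "\<And>n. open (N n)" "\<And>n. 0 \<in> N n" "\<And>n. \<forall>x\<in>K n. \<forall>v\<in>N n. x + v \<in> U"
    by metis
  obtain V where V: "nbhd_chain V" "\<And>n. V n \<subseteq> N n"
    using nbhd_chain_exists[of N, OF N(1,2)] by blast
  note VD = nbhd_chainD[OF V(1)]
  define H where "H = (\<Inter>n. V n)"
  define C where "C = {y. \<exists>n. \<forall>v\<in>V n. y + v \<in> U}"
  define W where "W = (\<Union>h\<in>H. {y. h + y \<in> U})"
  \<comment> \<open>The interior of \<open>U\<close> for the chain: one step of the chain stays inside it.\<close>
  have addC: "y + v \<in> C" if "\<forall>v\<in>V n. y + v \<in> U" "v \<in> V (Suc n)" for y v n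
    unfolding C_def
    using that VD(4) by (auto intro!: exI[of _ "Suc n"] simp: add.assoc)
  have KC: "K n \<subseteq> C" for n
    unfolding C_def using N(3) V(2) by blast
  have CU: "C \<subseteq> U" unfolding C_def using VD(2) by force
  have UW: "U \<subseteq> W" unfolding W_def H_def using VD(2) by force
  have "open C"
  proof (subst open_subopen, rule ballI)
    fix y assume "y \<in> C"
    then obtain n where n: "\<forall>v\<in>V n. y + v \<in> U" unfolding C_def by blast
    have "open {z. - y + z \<in> V (Suc n)}" by (rule open_translate[OF VD(1)])
    moreover have "{z. - y + z \<in> V (Suc n)} \<subseteq> C"
    proof
      fix z assume "z \<in> {z. - y + z \<in> V (Suc n)}"
      then show "z \<in> C" using addC[OF n, of "- y + z"] by simp
    qed
    ultimately show "\<exists>T. open T \<and> y \<in> T \<and> T \<subseteq> C"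
      using VD(2) by (intro exI[of _ "{z. - y + z \<in> V (Suc n)}"]) auto
  qed
  have "open W" unfolding W_def by (intro open_UN ballI open_translate U)
  have cC: "chain_open V C"
    unfolding chain_open_def using addC by (force simp: C_def)
  have cW: "chain_open V W"
    unfolding W_def H_def by (rule chain_open_saturation[OF compact_group V(1) U])
  have HC: "h + c \<in> C" if "c \<in> C" "h \<in> H" for h c
    using that addC unfolding H_def C_def
    by (auto simp: add.commute[of h])
  have measUC: "emeasure \<nu> U = emeasure \<nu> C"
  proof (rule antisym)
    have "emeasure \<nu> (K n) \<le> emeasure \<nu> C" for n
      using KC \<open>open C\<close> sets_haar by (intro emeasure_mono) auto
    then show "emeasure \<nu> U \<le> emeasure \<nu> C"
      unfolding k(2) K(3) by (intro SUP_least)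
    show "emeasure \<nu> C \<le> emeasure \<nu> U"
      using CU bU sets_haar by (intro emeasure_mono) auto
  qed
  have sC: "C \<in> sets \<nu>" and sU: "U \<in> sets \<nu>" and sW: "W \<in> sets \<nu>"
    using \<open>open C\<close> \<open>open W\<close> U sets_haar by auto
  have nullUC: "emeasure \<nu> (U - C) = 0"
    using emeasure_Diff[of \<nu> C U] sC sU CU measUC by simp
  have nullh: "{y. h + y \<in> U} - C \<in> null_sets \<nu>" if h: "h \<in> H" for h
  proof (rule null_setsI)
    have "{y. h + y \<in> U} - C \<subseteq> {y. h + y \<in> U - C}"
    proof
      fix y assume "y \<in> {y. h + y \<in> U} - C"
      then have y: "h + y \<in> U" "y \<notin> C" by blast+
      have "- h \<in> H" using h VD(3) unfolding H_def by blast
      then have "h + y \<in> C \<Longrightarrow> y \<in> C" using HC[of "h + y" "- h"] by simp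
      with y show "y \<in> {y. h + y \<in> U - C}" by blast
    qed
    moreover have "emeasure \<nu> {y. h + y \<in> U - C} = 0"
      using emeasure_preimage_translate[of "U - C" h] sC sU sets_haar nullUC by simp
    moreover have "{y. h + y \<in> U - C} \<in> sets \<nu>"
    proof -
      have "{y. h + y \<in> U - C} = {y. h + y \<in> U} - {y. h + y \<in> C}" by auto
      then show ?thesis
        using open_translate[OF U] open_translate[OF \<open>open C\<close>] sets_haar
        by (auto intro: borel_open)
    qed
    ultimately show "emeasure \<nu> ({y. h + y \<in> U} - C) = 0"
      by (metis emeasure_mono le_zero_eq)
    show "{y. h + y \<in> U} - C \<in> sets \<nu>"
      using open_translate[OF U] sC sets_haar by (auto intro: borel_open)
  qed
  have "emeasure \<nu> W \<le> emeasure \<nu> C"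
    unfolding inner_regular[OF borel_open[OF \<open>open W\<close>]]
  proof (rule SUP_least, clarify)
    fix L assume L: "compact L" "L \<subseteq> W"
    then obtain I where I: "I \<subseteq> H" "finite I" "L \<subseteq> (\<Union>h\<in>I. {y. h + y \<in> U})"
      using compactE_image[OF L(1), of H "\<lambda>h. {y. h + y \<in> U}"] open_translate[OF U]
      unfolding W_def by metis
    have null: "(\<Union>h\<in>I. {y. h + y \<in> U} - C) \<in> null_sets \<nu>"
      using nullh I(1,2) by (intro null_sets_UN') (auto simp: countable_finite)
    have "emeasure \<nu> L \<le> emeasure \<nu> (C \<union> (\<Union>h\<in>I. {y. h + y \<in> U} - C))"
      using I(3) null_setsD2[OF null] sC by (intro emeasure_mono sets.Un) auto
    also have "\<dots> = emeasure \<nu> C"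
      by (rule emeasure_Un_null_set[OF sC null])
    finally show "emeasure \<nu> L \<le> emeasure \<nu> C" .
  qed
  moreover have "emeasure \<nu> C \<le> emeasure \<nu> W"
    using CU UW sW by (intro emeasure_mono) auto
  ultimately have "emeasure \<nu> W = emeasure \<nu> C" by (rule antisym)
  with V(1) \<open>open C\<close> \<open>open W\<close> cC cW CU UW that show ?thesis by blast
qed

end

section \<open>Measurability of a random automorphism\<close>

lemma space_aut_borel: "space aut_borel = top_automorphisms"
  unfolding aut_borel_def by (simp add: space_measure_of_conv)

lemma openin_aut_topology_subset: "openin aut_topology W \<Longrightarrow> W \<subseteq> top_automorphisms"
  using openin_subset[of aut_topology W]
  unfolding aut_topology_def topology_generated_by_topspace by auto

lemma sets_aut_borel: "openin aut_topology W \<Longrightarrow> W \<in> sets aut_borel"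
  unfolding aut_borel_def using openin_aut_topology_subset
  by (subst sets_measure_of) (auto intro: sigma_sets.Basic)

lemma openin_aut_topology_point:
  assumes "open U"
  shows "openin aut_topology {T \<in> top_automorphisms. T x \<in> U}"
proof -
  have "openin aut_topology {T \<in> top_automorphisms. T ` {x} \<subseteq> U}"
    unfolding aut_topology_def using assms
    by (intro topology_generated_by_Basis UnI1 CollectI exI[of _ "{x}"] exI[of _ U]) simp
  then show ?thesis by simp
qed

text \<open>An intersection over all points of the group, usually uncountable, is measurable here
  because it is closed already for pointwise convergence.\<close>

lemma aut_borel_closed_constraints:
  assumes "\<And>x. closed (F x)"
  shows "{T \<in> top_automorphisms. \<forall>x. T x \<in> F x} \<in> sets aut_borel"
proof -
  have "openin aut_topology (\<Union>x. {T \<in> top_automorphisms. T x \<in> - F x})"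
    using openin_aut_topology_point[OF open_Compl[OF assms]] by (intro openin_Union) blast
  then have "space aut_borel - (\<Union>x. {T \<in> top_automorphisms. T x \<in> - F x}) \<in> sets aut_borel"
    by (intro sets.compl_sets sets_aut_borel)
  also have "space aut_borel - (\<Union>x. {T \<in> top_automorphisms. T x \<in> - F x}) =
      {T \<in> top_automorphisms. \<forall>x. T x \<in> F x}"
    unfolding space_aut_borel by auto
  finally show ?thesis .
qed

text \<open>The measure \<open>L\<close> stands for \<open>norm (\<Phi> u)\<close> times the measure on the parameters.  It is
  finite, so the separability condition can be required on the whole parameter space at once.\<close>

locale random_automorphism = haar_group \<nu> + L: finite_measure L
  for \<nu> :: "'g::{topological_ab_group_add, t2_space} measure" and L :: "'w measure" +
  fixes A :: "'w \<Rightarrow> 'g \<Rightarrow> 'g"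
  assumes A_measurable: "A \<in> L \<rightarrow>\<^sub>M aut_borel"
    and A_separable: "\<And>V. open V \<Longrightarrow> 0 \<in> V \<Longrightarrow> \<exists>D. countable D \<and> D \<subseteq> top_automorphisms \<and>
      (AE u in L. \<exists>T\<in>D. \<forall>x. A u x - T x \<in> V)"

sublocale random_automorphism \<subseteq> P: pair_sigma_finite L \<nu> ..

context random_automorphism
begin

lemma A_automorphism: "u \<in> space L \<Longrightarrow> A u \<in> top_automorphisms"
  using measurable_space[OF A_measurable] space_aut_borel by blast

lemma A_point_measurable [measurable]: "(\<lambda>u. A u x) \<in> borel_measurable L"
proof (rule borel_measurableI)
  fix S :: "'g set" assume "open S"
  then have "A -` {T \<in> top_automorphisms. T x \<in> S} \<inter> space L \<in> sets L"
    by (intro measurable_sets[OF A_measurable] sets_aut_borel openin_aut_topology_point)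
  also have "A -` {T \<in> top_automorphisms. T x \<in> S} \<inter> space L = (\<lambda>u. A u x) -` S \<inter> space L"
    using A_automorphism by auto
  finally show "(\<lambda>u. A u x) -` S \<inter> space L \<in> sets L" .
qed

text \<open>Separability supplies countably many automorphisms \<open>T\<close> that approximate \<open>A u\<close>
  uniformly to within \<open>V n\<close>.  Membership of \<open>A u x\<close> in \<open>W\<close> can be read off from
  that of \<open>T x\<close> in a slightly smaller set, once \<open>n\<close> is large, and this exhibits the
  preimage as a countable union of measurable rectangles.\<close>

lemma chain_open_measurable:
  assumes V: "nbhd_chain V" and W: "chain_open V W"
  obtains Q where "Q \<in> sets (L \<Otimes>\<^sub>M \<nu>)" "AE u in L. \<forall>x. (u, x) \<in> Q \<longleftrightarrow> A u x \<in> W"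
proof -
  note VD = nbhd_chainD[OF V]
  have "\<forall>n. \<exists>D. countable D \<and> D \<subseteq> top_automorphisms \<and>
      (AE u in L. \<exists>T\<in>D. \<forall>x. A u x - T x \<in> V (Suc n))"
    by (intro allI A_separable VD(1,2))
  then obtain D where "\<forall>n. countable (D n) \<and> D n \<subseteq> top_automorphisms \<and>
      (AE u in L. \<exists>T\<in>D n. \<forall>x. A u x - T x \<in> V (Suc n))"
    by (rule exE[OF choice])
  then have D: "\<And>n. countable (D n)" "\<And>n. D n \<subseteq> top_automorphisms"
    "\<And>n. AE u in L. \<exists>T\<in>D n. \<forall>x. A u x - T x \<in> V (Suc n)" by simp_all
  \<comment> \<open>The closure in \<open>B n T\<close> makes it a closed condition on \<open>A u\<close>; one step of the chain absorbs it.\<close>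
  define B where "B n T = {u \<in> space L. \<forall>x. A u x - T x \<in> closure (V (Suc n))}" for n T
  define O' where "O' n = interior {y. \<forall>v\<in>V n. y + v \<in> W}" for n
  define Q where "Q = (\<Union>n. \<Union>T\<in>D n. B n T \<times> T -` O' n)"
  have sB: "B n T \<in> sets L" for n T
  proof -
    have cl: "closed {y. y - T x \<in> closure (V (Suc n))}" for x
      using closed_vimage[OF closed_closure[of "V (Suc n)"], of "\<lambda>y. y + - T x"]
      by (simp add: vimage_def continuous_intros)
    have "A -` {S \<in> top_automorphisms. \<forall>x. S x \<in> {y. y - T x \<in> closure (V (Suc n))}} \<inter> space L
        \<in> sets L"
      by (intro measurable_sets[OF A_measurable] aut_borel_closed_constraints cl)
    also have "A -` {S \<in> top_automorphisms. \<forall>x. S x \<in> {y. y - T x \<in> closure (V (Suc n))}} \<inter> space L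
        = B n T"
      unfolding B_def using A_automorphism by auto
    finally show ?thesis .
  qed
  have sO: "T -` O' n \<in> sets \<nu>" if "T \<in> D n" for T n
  proof -
    have "open (O' n)" by (simp add: O'_def)
    then have "open (T -` O' n)"
      using top_automorphismD(3) D(2) that by (intro open_vimage) blast+
    then show ?thesis using sets_haar by simp
  qed
  have sQ: "Q \<in> sets (L \<Otimes>\<^sub>M \<nu>)"
    unfolding Q_def by (intro sets.countable_UN' D(1) sets.countable_UN image_subsetI pair_measureI sB sO)
  have "AE u in L. \<forall>n. \<exists>T\<in>D n. \<forall>x. A u x - T x \<in> V (Suc n)"
    unfolding AE_all_countable using D(3) by blast
  then have "AE u in L. \<forall>x. (u, x) \<in> Q \<longleftrightarrow> A u x \<in> W"
    using AE_space
  proof eventually_elim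
    case (elim u)
    show ?case
    proof (intro allI iffI)
      fix x assume "(u, x) \<in> Q"
      then obtain n T where T: "T \<in> D n" "u \<in> B n T" "T x \<in> O' n"
        unfolding Q_def by blast
      then have "A u x - T x \<in> V n" "T x \<in> {y. \<forall>v\<in>V n. y + v \<in> W}"
        using nbhd_chain_closure[OF V] interior_subset unfolding B_def O'_def by blast+
      then have "T x + (A u x - T x) \<in> W" by blast
      then show "A u x \<in> W" by simp
    next
      fix x assume "A u x \<in> W"
      then obtain m where m: "\<forall>v\<in>V m. A u x + v \<in> W"
        using W unfolding chain_open_def by blast
      obtain T where T: "T \<in> D (Suc m)" "\<forall>x. A u x - T x \<in> V (Suc (Suc m))"
        using elim(1) by blast
      let ?N = "{y. - A u x + y \<in> V (Suc (Suc m))}"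
      have "?N \<subseteq> {y. \<forall>v\<in>V (Suc m). y + v \<in> W}"
      proof clarify
        fix y v assume y: "- A u x + y \<in> V (Suc (Suc m))" and v: "v \<in> V (Suc m)"
        have "- A u x + y \<in> V (Suc m)"
          using y nbhd_chain_antimono[OF V, of "Suc m" "Suc (Suc m)"] by auto
        then have "(- A u x + y) + v \<in> V m" using v by (rule VD(4))
        then have "A u x + ((- A u x + y) + v) \<in> W" using m by blast
        then show "y + v \<in> W" by (simp add: algebra_simps)
      qed
      moreover have "open ?N" by (rule open_translate[OF VD(1)])
      moreover have "T x \<in> ?N"
        using VD(3)[OF T(2)[rule_format, of x]] by simp
      ultimately have "T x \<in> O' (Suc m)"
        unfolding O'_def by (meson interiorI)
      moreover have "u \<in> B (Suc m) T"
        using T(2) closure_subset elim(2) unfolding B_def by blast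
      ultimately show "(u, x) \<in> Q" unfolding Q_def using T(1) by blast
    qed
  qed
  with sQ that show ?thesis by blast
qed

text \<open>The preimage of an open set need not be product measurable.  But the inner and
  the outer set of the sandwich have product measurable preimages, up to a null set of parameters,
  and the difference is null, because each section is the preimage of a null set under an
  automorphism.\<close>

lemma joint_measurable:
  "(\<lambda>z. A (fst z) (snd z)) \<in> borel_measurable (completion (L \<Otimes>\<^sub>M \<nu>))"
proof (rule borel_measurableI)
  fix U :: "'g set" assume "open U"
  obtain V C W where CW: "nbhd_chain V" "open C" "open W" "chain_open V C" "chain_open V W"
    "C \<subseteq> U" "U \<subseteq> W" "emeasure \<nu> W = emeasure \<nu> C"
    by (rule chain_open_sandwich[OF \<open>open U\<close>])
  obtain QC where QC: "QC \<in> sets (L \<Otimes>\<^sub>M \<nu>)" "AE u in L. \<forall>x. (u, x) \<in> QC \<longleftrightarrow> A u x \<in> C"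
    by (rule chain_open_measurable[OF CW(1,4)])
  obtain QW where QW: "QW \<in> sets (L \<Otimes>\<^sub>M \<nu>)" "AE u in L. \<forall>x. (u, x) \<in> QW \<longleftrightarrow> A u x \<in> W"
    by (rule chain_open_measurable[OF CW(1,5)])
  have sC: "C \<in> sets \<nu>" and sW: "W \<in> sets \<nu>" using CW(2,3) sets_haar by simp_all
  have nullWC: "emeasure \<nu> (W - C) = 0"
    using emeasure_Diff[of \<nu> C W] sC sW CW(6-8) by auto
  let ?S = "(\<lambda>z. A (fst z) (snd z)) -` U \<inter> space (completion (L \<Otimes>\<^sub>M \<nu>))"
  have "AE u in L. (\<forall>x. (u, x) \<in> QC \<longleftrightarrow> A u x \<in> C) \<and> (\<forall>x. (u, x) \<in> QW \<longleftrightarrow> A u x \<in> W)"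
    using QC(2) QW(2) by eventually_elim blast
  then obtain N where N: "{u \<in> space L. \<not> ((\<forall>x. (u, x) \<in> QC \<longleftrightarrow> A u x \<in> C) \<and>
      (\<forall>x. (u, x) \<in> QW \<longleftrightarrow> A u x \<in> W))} \<subseteq> N" "N \<in> null_sets L"
    by (rule AE_E) (auto intro: null_setsI)
  have N': "N \<times> UNIV \<in> null_sets (L \<Otimes>\<^sub>M \<nu>)"
    using N(2) sets.top[of \<nu>]
    by (intro null_setsI) (auto simp: emeasure_pair_measure_Times[OF null_setsD2[OF N(2)]] null_setsD1)
  have "AE u in L. emeasure \<nu> (Pair u -` (QW - QC)) = 0"
    using QC(2) QW(2) AE_space
  proof eventually_elim
    case (elim u)
    have "Pair u -` (QW - QC) = A u -` (W - C)" using elim by auto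
    moreover have "emeasure \<nu> (A u -` (W - C)) = emeasure (distr \<nu> borel (A u)) (W - C)"
      using top_automorphismD(4)[OF A_automorphism[OF elim(3)]] sC sW sets_haar
      by (subst emeasure_distr) auto
    ultimately show ?case
      using distr_top_automorphism[OF A_automorphism[OF elim(3)]] nullWC by simp
  qed
  then have "emeasure (L \<Otimes>\<^sub>M \<nu>) (QW - QC) = 0"
    using QC(1) QW(1) by (subst emeasure_pair_measure_alt) (auto simp: nn_integral_0_iff_AE)
  then have "(QW - QC) \<union> N \<times> UNIV \<in> null_sets (L \<Otimes>\<^sub>M \<nu>)"
    using QC(1) QW(1) N' by (intro null_sets.Un null_setsI) auto
  moreover have "?S - QC \<subseteq> (QW - QC) \<union> N \<times> UNIV"
    using N(1) CW(7) by (fastforce simp: space_pair_measure)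
  moreover have "QC - ?S \<subseteq> (QW - QC) \<union> N \<times> UNIV"
  proof
    fix z assume *: "z \<in> QC - ?S"
    obtain u x where z: "z = (u, x)" by (cases z)
    have "u \<in> space L"
      using * sets.sets_into_space[OF QC(1)] by (auto simp: z space_pair_measure)
    with * N(1) CW(6) show "z \<in> (QW - QC) \<union> N \<times> UNIV"
      by (auto simp: z space_pair_measure)
  qed
  ultimately have 1: "?S - QC \<in> sets (completion (L \<Otimes>\<^sub>M \<nu>))"
    and 2: "QC - ?S \<in> sets (completion (L \<Otimes>\<^sub>M \<nu>))"
    using sets_completionI_sub by blast+
  have "QC - (QC - ?S) \<union> (?S - QC) \<in> sets (completion (L \<Otimes>\<^sub>M \<nu>))"
    by (rule sets.Un[OF sets.Diff[OF sets_completionI_sets[OF QC(1)] 2] 1])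
  also have "QC - (QC - ?S) \<union> (?S - QC) = ?S" by blast
  finally show "?S \<in> sets (completion (L \<Otimes>\<^sub>M \<nu>))" .
qed

lemma AE_pair_both:
  assumes "AE z in L \<Otimes>\<^sub>M \<nu>. Q z"
  shows "AE u in L. AE x in \<nu>. Q (u, x)" "AE x in \<nu>. AE u in L. Q (u, x)"
proof -
  show "AE u in L. AE x in \<nu>. Q (u, x)" by (rule P.AE_pair[OF assms])
  obtain N where N: "{z \<in> space (L \<Otimes>\<^sub>M \<nu>). \<not> Q z} \<subseteq> N" "N \<in> sets (L \<Otimes>\<^sub>M \<nu>)"
    "emeasure (L \<Otimes>\<^sub>M \<nu>) N = 0"
    by (rule AE_E[OF assms])
  have "AE z in L \<Otimes>\<^sub>M \<nu>. z \<notin> N"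
    using N by (intro AE_not_in null_setsI)
  then have "AE u in L. AE x in \<nu>. (u, x) \<notin> N" by (rule P.AE_pair)
  moreover have "{z \<in> space (L \<Otimes>\<^sub>M \<nu>). (fst z, snd z) \<notin> N} \<in> sets (L \<Otimes>\<^sub>M \<nu>)"
    using N(2) by measurable
  ultimately have "AE x in \<nu>. AE u in L. (u, x) \<notin> N"
    using P.AE_commute[of "\<lambda>u x. (u, x) \<notin> N"] by blast
  then show "AE x in \<nu>. AE u in L. Q (u, x)"
  proof eventually_elim
    case (elim x)
    then show ?case using AE_space
      by eventually_elim (use N(1) in \<open>auto simp: space_pair_measure\<close>)
  qed
qed

text \<open>The composite \<open>f (A u x)\<close> is measurable only for the completed product, to which
  Fubini's theorem does not apply directly; the product measurable function \<open>F\<close> replaces it.\<close>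

lemma joint_version:
  fixes f :: "'g \<Rightarrow> complex"
  assumes f: "f \<in> borel_measurable borel"
  obtains F where "F \<in> borel_measurable (L \<Otimes>\<^sub>M \<nu>)"
    "AE u in L. AE x in \<nu>. F (u, x) = f (A u x)"
    "AE x in \<nu>. AE u in L. F (u, x) = f (A u x)"
proof -
  let ?g = "\<lambda>z. f (A (fst z) (snd z))"
  have "?g \<in> borel_measurable (completion (L \<Otimes>\<^sub>M \<nu>))"
    by (rule measurable_compose[OF joint_measurable f])
  then have "(\<lambda>z. Re (?g z)) \<in> borel_measurable (completion (L \<Otimes>\<^sub>M \<nu>))"
    "(\<lambda>z. Im (?g z)) \<in> borel_measurable (completion (L \<Otimes>\<^sub>M \<nu>))"
    by measurable
  then obtain R I where RI: "R \<in> borel_measurable (L \<Otimes>\<^sub>M \<nu>)" "I \<in> borel_measurable (L \<Otimes>\<^sub>M \<nu>)"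
    "AE z in L \<Otimes>\<^sub>M \<nu>. Re (?g z) = R z" "AE z in L \<Otimes>\<^sub>M \<nu>. Im (?g z) = I z"
    using completion_ex_borel_measurable_real[of "\<lambda>z. Re (?g z)"]
      completion_ex_borel_measurable_real[of "\<lambda>z. Im (?g z)"] by blast
  define F where "F = (\<lambda>z. Complex (R z) (I z))"
  have F1: "F \<in> borel_measurable (L \<Otimes>\<^sub>M \<nu>)"
    using RI(1,2) unfolding F_def borel_measurable_complex_iff by simp
  have F2: "AE z in L \<Otimes>\<^sub>M \<nu>. F z = ?g z"
    using RI(3,4) by eventually_elim (simp add: F_def complex_eq_iff)
  show ?thesis
    by (rule that[OF F1]) (use AE_pair_both[OF F2] in simp_all)
qed

lemma AE_automorphism:
  assumes "T \<in> top_automorphisms" "AE y in \<nu>. P y"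
  shows "AE x in \<nu>. P (T x)"
proof -
  have "AE y in distr \<nu> borel T. P y"
    unfolding distr_top_automorphism[OF assms(1)] by (rule assms(2))
  then show ?thesis
    using top_automorphismD(4)[OF assms(1)] sets_haar
    by (intro AE_distrD[of T \<nu> borel]) auto
qed

text \<open>Null sets are carried to null sets for each \<open>u\<close>; exchanging the order of the two
  almost-everywhere quantifiers needs the product measurable version of the indicator.\<close>

lemma AE_random_automorphism:
  assumes "AE y in \<nu>. P y"
  shows "AE x in \<nu>. AE u in L. P (A u x)"
proof -
  obtain N where N: "{y \<in> space \<nu>. \<not> P y} \<subseteq> N" "N \<in> sets \<nu>" "emeasure \<nu> N = 0"
    by (rule AE_E[OF assms])
  have ae: "AE y in \<nu>. y \<notin> N" using N by (intro AE_not_in null_setsI)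
  have N': "N \<in> sets borel" using N(2) sets_haar by simp
  obtain F where F: "F \<in> borel_measurable (L \<Otimes>\<^sub>M \<nu>)"
    "AE u in L. AE x in \<nu>. F (u, x) = (indicator N (A u x) :: complex)"
    "AE x in \<nu>. AE u in L. F (u, x) = (indicator N (A u x) :: complex)"
    by (rule joint_version[OF borel_measurable_indicator[OF N']])
  note [measurable] = F(1)
  have "AE u in L. AE x in \<nu>. F (u, x) = 0"
    using F(2) AE_space
  proof eventually_elim
    case (elim u)
    show ?case using elim(1) AE_automorphism[OF A_automorphism[OF elim(2)] ae]
      by eventually_elim simp
  qed
  then have "AE x in \<nu>. AE u in L. F (u, x) = 0"
    by (subst (asm) P.AE_commute) measurable
  then show ?thesis
    using F(3)
  proof eventually_elim
    case (elim x)
    then show ?case by eventually_elim (use N(1) in \<open>auto split: split_indicator_asm\<close>)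
  qed
qed

end

section \<open>Averages over random automorphisms\<close>

context haar_group
begin

lemma integrable_automorphism:
  fixes f :: "'g \<Rightarrow> 'b::{banach, second_countable_topology}"
  assumes T: "T \<in> top_automorphisms" and f: "f \<in> borel_measurable borel"
  shows "integrable \<nu> (\<lambda>x. f (T x)) \<longleftrightarrow> integrable \<nu> f"
    and "(\<integral>x. f (T x) \<partial>\<nu>) = (\<integral>x. f x \<partial>\<nu>)"
proof -
  have T': "T \<in> \<nu> \<rightarrow>\<^sub>M borel"
    using top_automorphismD(4)[OF T] sets_haar by simp
  show "integrable \<nu> (\<lambda>x. f (T x)) \<longleftrightarrow> integrable \<nu> f"
    using integrable_distr_eq[OF T' f] distr_top_automorphism[OF T] by simp
  show "(\<integral>x. f (T x) \<partial>\<nu>) = (\<integral>x. f x \<partial>\<nu>)"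
    using integral_distr[OF T' f] distr_top_automorphism[OF T] by simp
qed

end

text \<open>Jensen's inequality for the power function.  With \<open>c\<close> the mean of \<open>h\<close>, Young's
  inequality bounds \<open>h * c powr (p - 1)\<close> by a convex combination of \<open>h powr p\<close> and
  \<open>c powr p\<close>; integrating it leaves exactly the claim.\<close>

lemma (in finite_measure) integral_powr_Jensen:
  fixes h :: "'a \<Rightarrow> real"
  assumes p: "1 \<le> p" and h: "integrable M h" "\<And>x. 0 \<le> h x"
    and hp: "integrable M (\<lambda>x. h x powr p)"
  shows "(\<integral>x. h x \<partial>M) powr p \<le> measure M (space M) powr (p - 1) * (\<integral>x. h x powr p \<partial>M)"
proof (cases "(\<integral>x. h x \<partial>M) = 0")
  case True
  then show ?thesis by (simp add: integral_nonneg_AE)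
next
  case False
  define m where "m = measure M (space M)"
  define c where "c = (\<integral>x. h x \<partial>M) / m"
  have I: "(\<integral>x. h x \<partial>M) > 0"
    using False h(2) by (simp add: order_less_le integral_nonneg_AE)
  have m: "m > 0"
  proof (rule ccontr)
    assume "\<not> m > 0"
    then have "emeasure M (space M) = 0"
      unfolding m_def by (simp add: emeasure_eq_measure zero_less_measure_iff)
    then have "AE x in M. h x = 0"
      by (intro AE_I[of _ _ "space M"]) auto
    then have "(\<integral>x. h x \<partial>M) = 0" by (simp add: integral_eq_zero_AE)
    with I show False by simp
  qed
  have c: "c > 0" using I m by (simp add: c_def)
  have young: "h x * c powr (p - 1) \<le> (1 / p) * h x powr p + (1 - 1 / p) * c powr p" for x
  proof (cases "h x = 0")
    case True
    then show ?thesis using p by simp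
  next
    case False
    then have hx: "h x > 0" using h(2)[of x] by simp
    have "(h x powr p) powr (1 / p) * (c powr p) powr (1 - 1 / p)
        \<le> (1 / p) * h x powr p + (1 - 1 / p) * c powr p"
      using p hx c by (intro Youngs_inequality_0) auto
    moreover have "(h x powr p) powr (1 / p) = h x"
      using p hx by (simp add: powr_powr)
    moreover have "(c powr p) powr (1 - 1 / p) = c powr (p - 1)"
      using p c by (simp add: powr_powr algebra_simps)
    ultimately show ?thesis by simp
  qed
  have "(\<integral>x. h x * c powr (p - 1) \<partial>M)
      \<le> (\<integral>x. (1 / p) * h x powr p + (1 - 1 / p) * c powr p \<partial>M)"
    using h(1) hp by (intro integral_mono young) auto
  then have "(\<integral>x. h x \<partial>M) * c powr (p - 1)
      \<le> (1 / p) * (\<integral>x. h x powr p \<partial>M) + m * ((1 - 1 / p) * c powr p)"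
    using h(1) hp by (simp add: m_def)
  moreover have "(\<integral>x. h x \<partial>M) = m * c" using m by (simp add: c_def)
  moreover have "c * c powr (p - 1) = c powr p"
    using c by (simp add: powr_diff)
  ultimately have "m * c powr p \<le> (1 / p) * (\<integral>x. h x powr p \<partial>M) + m * ((1 - 1 / p) * c powr p)"
    by (simp only: mult.assoc)
  then have "(1 / p) * (m * c powr p) \<le> (1 / p) * (\<integral>x. h x powr p \<partial>M)"
    by (simp add: algebra_simps)
  then have *: "m * c powr p \<le> (\<integral>x. h x powr p \<partial>M)"
    using p by (simp add: field_simps)
  have "(\<integral>x. h x \<partial>M) powr p = (m * c) powr p" using m by (simp add: c_def)
  also have "\<dots> = m powr (p - 1) * (m * c powr p)"
    using m c by (simp add: powr_mult powr_diff)
  also have "\<dots> \<le> m powr (p - 1) * (\<integral>x. h x powr p \<partial>M)"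
    by (intro mult_left_mono *) simp
  finally show ?thesis by (simp add: m_def)
qed

context random_automorphism
begin

text \<open>Almost every section of \<open>F\<close> is \<open>f \<circ> A u\<close> almost everywhere, and all of these have
  the same integrals as \<open>f\<close>.  The function \<open>\<phi>\<close> covers both the values themselves and the
  powers of their norms.\<close>

lemma joint_version_integral:
  fixes \<phi> :: "complex \<Rightarrow> 'b::{banach, second_countable_topology}"
  assumes [measurable]: "f \<in> borel_measurable borel" "F \<in> borel_measurable (L \<Otimes>\<^sub>M \<nu>)"
      "\<phi> \<in> borel_measurable borel"
    and F: "AE u in L. AE x in \<nu>. F (u, x) = f (A u x)"
    and int: "integrable \<nu> (\<lambda>x. \<phi> (f x))"
  shows "integrable (L \<Otimes>\<^sub>M \<nu>) (\<lambda>z. \<phi> (F z))"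
    and "(\<integral>z. \<phi> (F z) \<partial>(L \<Otimes>\<^sub>M \<nu>)) = measure L (space L) *\<^sub>R (\<integral>x. \<phi> (f x) \<partial>\<nu>)"
proof -
  have sect: "integrable \<nu> (\<lambda>x. \<phi> (F (u, x))) \<and>
      (\<integral>x. norm (\<phi> (F (u, x))) \<partial>\<nu>) = (\<integral>x. norm (\<phi> (f x)) \<partial>\<nu>) \<and>
      (\<integral>x. \<phi> (F (u, x)) \<partial>\<nu>) = (\<integral>x. \<phi> (f x) \<partial>\<nu>)"
    if u: "u \<in> space L" and Fu: "AE x in \<nu>. F (u, x) = f (A u x)" for u
  proof -
    note A = A_automorphism[OF u]
    note [measurable] = top_automorphismD(4)[OF A]
    have [measurable]: "(\<lambda>x. F (u, x)) \<in> borel_measurable \<nu>"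
      using u by (intro measurable_Pair2[OF assms(2)])
    have 1: "AE x in \<nu>. \<phi> (F (u, x)) = \<phi> (f (A u x))"
      using Fu by eventually_elim simp
    have 2: "AE x in \<nu>. norm (\<phi> (F (u, x))) = norm (\<phi> (f (A u x)))"
      using Fu by eventually_elim simp
    have "integrable \<nu> (\<lambda>x. \<phi> (f (A u x)))"
      using integrable_automorphism(1)[OF A, of "\<lambda>x. \<phi> (f x)"] int by simp
    then have "integrable \<nu> (\<lambda>x. \<phi> (F (u, x)))"
      using 1 by (subst integrable_cong_AE[OF _ _ 1]) measurable
    moreover have "(\<integral>x. norm (\<phi> (F (u, x))) \<partial>\<nu>) = (\<integral>x. norm (\<phi> (f (A u x))) \<partial>\<nu>)"
      by (rule integral_cong_AE[OF _ _ 2]) measurable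
    moreover have "(\<integral>x. \<phi> (F (u, x)) \<partial>\<nu>) = (\<integral>x. \<phi> (f (A u x)) \<partial>\<nu>)"
      by (rule integral_cong_AE[OF _ _ 1]) measurable
    ultimately show ?thesis
      using integrable_automorphism(2)[OF A, of "\<lambda>x. norm (\<phi> (f x))"]
        integrable_automorphism(2)[OF A, of "\<lambda>x. \<phi> (f x)"] by simp
  qed
  have ae: "AE u in L. integrable \<nu> (\<lambda>x. \<phi> (F (u, x))) \<and>
      (\<integral>x. norm (\<phi> (F (u, x))) \<partial>\<nu>) = (\<integral>x. norm (\<phi> (f x)) \<partial>\<nu>) \<and>
      (\<integral>x. \<phi> (F (u, x)) \<partial>\<nu>) = (\<integral>x. \<phi> (f x) \<partial>\<nu>)"
    using F AE_space by eventually_elim (use sect in blast)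
  show intF: "integrable (L \<Otimes>\<^sub>M \<nu>) (\<lambda>z. \<phi> (F z))"
  proof (rule P.Fubini_integrable)
    have "integrable L (\<lambda>u. \<integral>x. norm (\<phi> (F (u, x))) \<partial>\<nu>) \<longleftrightarrow>
        integrable L (\<lambda>u. \<integral>x. norm (\<phi> (f x)) \<partial>\<nu>)"
      by (rule integrable_cong_AE) (use ae in \<open>measurable, auto\<close>)
    then show "integrable L (\<lambda>u. \<integral>x. norm (\<phi> (F (u, x))) \<partial>\<nu>)" by simp
    show "AE u in L. integrable \<nu> (\<lambda>x. \<phi> (F (u, x)))" using ae by auto
  qed measurable
  have "(\<integral>z. \<phi> (F z) \<partial>(L \<Otimes>\<^sub>M \<nu>)) = (\<integral>u. \<integral>x. \<phi> (F (u, x)) \<partial>\<nu> \<partial>L)"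
    using P.integral_fst'[OF intF] by simp
  also have "\<dots> = (\<integral>u. \<integral>x. \<phi> (f x) \<partial>\<nu> \<partial>L)"
    by (rule integral_cong_AE) (use ae in \<open>measurable, auto\<close>)
  finally show "(\<integral>z. \<phi> (F z) \<partial>(L \<Otimes>\<^sub>M \<nu>)) = measure L (space L) *\<^sub>R (\<integral>x. \<phi> (f x) \<partial>\<nu>)"
    by simp
qed

lemma AE_integrable_random_automorphism:
  fixes f :: "'g \<Rightarrow> complex"
  assumes f [measurable]: "f \<in> borel_measurable borel" and int: "integrable \<nu> f"
  shows "AE x in \<nu>. integrable L (\<lambda>u. f (A u x))"
proof -
  obtain F where F: "F \<in> borel_measurable (L \<Otimes>\<^sub>M \<nu>)"
    "AE u in L. AE x in \<nu>. F (u, x) = f (A u x)" "AE x in \<nu>. AE u in L. F (u, x) = f (A u x)"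
    by (rule joint_version[OF f])
  have "integrable (L \<Otimes>\<^sub>M \<nu>) (\<lambda>(u, x). F (u, x))"
    using joint_version_integral(1)[OF f F(1) _ F(2), of "\<lambda>y. y"] int by simp
  from P.AE_integrable_snd[OF this] F(3) show ?thesis
  proof eventually_elim
    case (elim x)
    have "(\<lambda>u. f (A u x)) \<in> borel_measurable L" by measurable
    from elim(1) this elim(2) show ?case by (rule integrable_cong_AE_imp)
  qed
qed

text \<open>In the following lemmas \<open>s\<close> stands for the phase of the kernel, whose modulus is
  the density of \<open>L\<close>.  The function \<open>x \<mapsto> \<integral>u. s u * f (A u x) \<partial>L\<close> may become
  measurable only after a change on a null set, so a Borel function \<open>g\<close> stands in for it.\<close>

lemma weighted_average_version:
  fixes f :: "'g \<Rightarrow> complex" and s :: "'w \<Rightarrow> complex"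
  assumes f [measurable]: "f \<in> borel_measurable borel" and int: "integrable \<nu> f"
    and s [measurable]: "s \<in> borel_measurable L" and s1: "\<And>u. norm (s u) \<le> 1"
  obtains g where "g \<in> borel_measurable borel" "AE x in \<nu>. g x = (\<integral>u. s u * f (A u x) \<partial>L)"
    "\<forall>k\<in>borel_measurable borel. (\<forall>x. norm (k x) \<le> 1) \<longrightarrow>
      (AE u in L. (\<integral>x. f (A u x) * k x \<partial>\<nu>) = 0) \<longrightarrow> (\<integral>x. g x * k x \<partial>\<nu>) = 0"
proof -
  obtain F where F: "F \<in> borel_measurable (L \<Otimes>\<^sub>M \<nu>)"
    "AE u in L. AE x in \<nu>. F (u, x) = f (A u x)" "AE x in \<nu>. AE u in L. F (u, x) = f (A u x)"
    by (rule joint_version[OF f])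
  note [measurable] = F(1)
  have intF: "integrable (L \<Otimes>\<^sub>M \<nu>) F"
    using joint_version_integral(1)[OF f F(1) _ F(2), of "\<lambda>y. y"] int by simp
  define g where "g x = (\<integral>u. s u * F (u, x) \<partial>L)" for x
  have "(\<lambda>x. \<integral>u. s u * F (u, x) \<partial>L) \<in> borel_measurable \<nu>" by measurable
  then have 1: "g \<in> borel_measurable borel" unfolding g_def using sets_haar by simp
  have 2: "AE x in \<nu>. g x = (\<integral>u. s u * f (A u x) \<partial>L)"
    using F(3)
  proof eventually_elim
    case (elim x)
    show ?case unfolding g_def
      by (rule integral_cong_AE) (use elim in \<open>measurable, auto\<close>)
  qed
  have 3: "(\<integral>x. g x * k x \<partial>\<nu>) = 0"
    if k: "k \<in> borel_measurable borel" and k1: "\<And>x. norm (k x) \<le> 1"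
      and zero: "AE u in L. (\<integral>x. f (A u x) * k x \<partial>\<nu>) = 0" for k :: "'g \<Rightarrow> complex"
  proof -
    have k' [measurable]: "k \<in> borel_measurable \<nu>" using k sets_haar by simp
    have intk: "integrable (L \<Otimes>\<^sub>M \<nu>) (\<lambda>(u, x). s u * F (u, x) * k x)"
    proof (rule Bochner_Integration.integrable_bound[OF intF])
      show "AE z in L \<Otimes>\<^sub>M \<nu>. norm (case z of (u, x) \<Rightarrow> s u * F (u, x) * k x) \<le> norm (F z)"
      proof (rule AE_I2, clarsimp simp: norm_mult)
        fix u x
        have "norm (s u) * norm (F (u, x)) * norm (k x) \<le> 1 * norm (F (u, x)) * 1"
          by (intro mult_mono s1 k1) auto
        then show "norm (s u) * norm (F (u, x)) * norm (k x) \<le> norm (F (u, x))" by simp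
      qed
    qed measurable
    have "(\<integral>x. g x * k x \<partial>\<nu>) = (\<integral>x. \<integral>u. s u * F (u, x) * k x \<partial>L \<partial>\<nu>)"
      unfolding g_def by simp
    also have "\<dots> = (\<integral>u. \<integral>x. s u * F (u, x) * k x \<partial>\<nu> \<partial>L)"
      by (rule P.Fubini_integral[OF intk])
    also have "\<dots> = (\<integral>u. s u * (\<integral>x. F (u, x) * k x \<partial>\<nu>) \<partial>L)"
      by (simp add: mult.assoc)
    also have "\<dots> = 0"
    proof (rule integral_eq_zero_AE)
      show "AE u in L. s u * (\<integral>x. F (u, x) * k x \<partial>\<nu>) = 0"
        using zero F(2) AE_space
      proof eventually_elim
        case (elim u)
        have [measurable]: "(\<lambda>x. F (u, x)) \<in> borel_measurable \<nu>"
          using elim(3) by (intro measurable_Pair2[OF F(1)])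
        note [measurable] = top_automorphismD(4)[OF A_automorphism[OF elim(3)]]
        have "(\<integral>x. F (u, x) * k x \<partial>\<nu>) = (\<integral>x. f (A u x) * k x \<partial>\<nu>)"
          by (rule integral_cong_AE) (use elim(2) in \<open>measurable, auto\<close>)
        with elim(1) show ?case by simp
      qed
    qed
    finally show ?thesis .
  qed
  show ?thesis by (rule that[OF 1 2]) (use 3 in blast)
qed

lemma weighted_average_powr:
  fixes f g :: "'g \<Rightarrow> complex" and s :: "'w \<Rightarrow> complex"
  assumes p: "1 \<le> p" and f [measurable]: "f \<in> borel_measurable borel"
    and int: "integrable \<nu> f" and intp: "integrable \<nu> (\<lambda>x. norm (f x) powr p)"
    and s [measurable]: "s \<in> borel_measurable L" and s1: "\<And>u. norm (s u) \<le> 1"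
    and g: "g \<in> borel_measurable borel" "AE x in \<nu>. g x = (\<integral>u. s u * f (A u x) \<partial>L)"
  shows "integrable \<nu> (\<lambda>x. norm (g x) powr p)"
    and "(\<integral>x. norm (g x) powr p \<partial>\<nu>) \<le> measure L (space L) powr p * (\<integral>x. norm (f x) powr p \<partial>\<nu>)"
proof -
  let ?m = "measure L (space L)"
  obtain F where F: "F \<in> borel_measurable (L \<Otimes>\<^sub>M \<nu>)"
    "AE u in L. AE x in \<nu>. F (u, x) = f (A u x)" "AE x in \<nu>. AE u in L. F (u, x) = f (A u x)"
    by (rule joint_version[OF f])
  note [measurable] = F(1)
  have g' [measurable]: "g \<in> borel_measurable \<nu>" using g(1) sets_haar by simp
  have intF: "integrable (L \<Otimes>\<^sub>M \<nu>) (\<lambda>(u, x). F (u, x))"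
    using joint_version_integral(1)[OF f F(1) _ F(2), of "\<lambda>y. y"] int by simp
  have intFp: "integrable (L \<Otimes>\<^sub>M \<nu>) (\<lambda>(u, x). norm (F (u, x)) powr p)"
    and eqFp: "(\<integral>z. norm (F z) powr p \<partial>(L \<Otimes>\<^sub>M \<nu>)) = ?m * (\<integral>x. norm (f x) powr p \<partial>\<nu>)"
    using joint_version_integral[OF f F(1) _ F(2) intp] by (simp_all add: case_prod_beta')
  have pw: "AE x in \<nu>. norm (g x) powr p \<le> ?m powr (p - 1) * (\<integral>u. norm (F (u, x)) powr p \<partial>L)"
    using g(2) F(3) P.AE_integrable_snd[OF intF] P.AE_integrable_snd[OF intFp] AE_space
  proof eventually_elim
    case (elim x)
    have [measurable]: "(\<lambda>u. F (u, x)) \<in> borel_measurable L"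
      using elim(5) by (intro measurable_Pair1[OF F(1)])
    have "g x = (\<integral>u. s u * F (u, x) \<partial>L)"
      unfolding elim(1) by (rule integral_cong_AE) (use elim(2) in \<open>measurable, auto\<close>)
    then have "norm (g x) \<le> (\<integral>u. norm (s u * F (u, x)) \<partial>L)"
      using integral_norm_bound by metis
    also have "\<dots> \<le> (\<integral>u. norm (F (u, x)) \<partial>L)"
      using elim(3) mult_right_mono[OF s1] by (intro integral_mono_AE') (auto simp: norm_mult)
    finally have "norm (g x) powr p \<le> (\<integral>u. norm (F (u, x)) \<partial>L) powr p"
      using p by (intro powr_mono2) auto
    also have "\<dots> \<le> ?m powr (p - 1) * (\<integral>u. norm (F (u, x)) powr p \<partial>L)"
      using elim(3,4) by (intro L.integral_powr_Jensen p) auto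
    finally show ?case .
  qed
  have R: "integrable \<nu> (\<lambda>x. ?m powr (p - 1) * (\<integral>u. norm (F (u, x)) powr p \<partial>L))"
    using P.integrable_snd[OF intFp] by simp
  show I: "integrable \<nu> (\<lambda>x. norm (g x) powr p)"
    by (rule Bochner_Integration.integrable_bound[OF R]) (use pw in \<open>measurable, auto\<close>)
  have "(\<integral>x. norm (g x) powr p \<partial>\<nu>) \<le> (\<integral>x. ?m powr (p - 1) * (\<integral>u. norm (F (u, x)) powr p \<partial>L) \<partial>\<nu>)"
    by (rule integral_mono_AE[OF I R pw])
  also have "\<dots> = ?m powr (p - 1) * (?m * (\<integral>x. norm (f x) powr p \<partial>\<nu>))"
    using P.integral_snd[OF intFp] eqFp by (simp add: case_prod_beta')
  also have "\<dots> = ?m powr p * (\<integral>x. norm (f x) powr p \<partial>\<nu>)"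
    by (cases "?m = 0") (simp_all add: powr_diff)
  finally show "(\<integral>x. norm (g x) powr p \<partial>\<nu>) \<le> ?m powr p * (\<integral>x. norm (f x) powr p \<partial>\<nu>)" .
qed

lemma weighted_average_bounded:
  fixes f :: "'g \<Rightarrow> complex" and s :: "'w \<Rightarrow> complex"
  assumes f: "AE x in \<nu>. norm (f x) \<le> c" and s1: "\<And>u. norm (s u) \<le> 1"
  shows "AE x in \<nu>. norm (\<integral>u. s u * f (A u x) \<partial>L) \<le> measure L (space L) * c"
proof -
  have "AE x in \<nu>. 0 \<le> c"
    using f by eventually_elim (rule order_trans[OF norm_ge_zero])
  then have "0 \<le> c" by simp
  show ?thesis
    using AE_random_automorphism[OF f]
  proof eventually_elim
    case (elim x)
    have "norm (\<integral>u. s u * f (A u x) \<partial>L) \<le> (\<integral>u. norm (s u * f (A u x)) \<partial>L)"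
      by (rule integral_norm_bound)
    also have "\<dots> \<le> (\<integral>u. c \<partial>L)"
    proof (rule integral_mono_AE')
      show "AE u in L. norm (s u * f (A u x)) \<le> c"
        using elim
      proof eventually_elim
        case (elim u)
        have "norm (s u) * norm (f (A u x)) \<le> 1 * norm (f (A u x))"
          by (intro mult_right_mono s1) simp
        with elim show ?case by (simp add: norm_mult)
      qed
    qed (use \<open>0 \<le> c\<close> in auto)
    finally show ?case by simp
  qed
qed

end

section \<open>Hardy spaces and their norms\<close>

lemma character_comp_inv:
  assumes T: "T \<in> top_automorphisms" and \<gamma>: "\<gamma> \<in> characters"
  shows "\<gamma> \<circ> inv T \<in> characters"
proof -
  have bij: "bij T" using top_automorphismD(1)[OF T] .
  have add: "inv T (x + y) = inv T x + inv T y" for x y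
    using top_automorphismD(2)[OF T, of "inv T x" "inv T y"] bij
    by (metis bij_inv_eq_iff)
  have "continuous_on UNIV (inv T)" using T unfolding top_automorphisms_def by blast
  then have "continuous_on UNIV (\<gamma> \<circ> inv T)"
    using \<gamma> unfolding characters_def
    by (intro continuous_on_compose) (auto intro: continuous_on_subset)
  then show ?thesis using \<gamma> add unfolding characters_def by simp
qed

lemma inv_dual_aut:
  assumes T: "T \<in> top_automorphisms" and \<gamma>: "\<gamma> \<in> characters"
  shows "inv_into characters (dual_aut T) \<gamma> = \<gamma> \<circ> inv T"
proof (rule inv_into_f_eq)
  have bij: "bij T" using top_automorphismD(1)[OF T] .
  show "inj_on (dual_aut T) characters"
    unfolding dual_aut_def using bij by (intro inj_onI) (metis bij_is_surj fun.inj_map_strong comp_assoc surj_iff comp_id)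
  show "\<gamma> \<circ> inv T \<in> characters" by (rule character_comp_inv[OF T \<gamma>])
  show "dual_aut T (\<gamma> \<circ> inv T) = \<gamma>"
    unfolding dual_aut_def using bij by (simp add: comp_assoc bij_is_inj)
qed

context haar_group
begin

lemma Lp_space_integrable:
  assumes p: "1 \<le> p" and f: "f \<in> Lp_space \<nu> p"
  shows "f \<in> borel_measurable borel" "integrable \<nu> f"
proof -
  have f': "f \<in> borel_measurable \<nu>" using f unfolding Lp_space_def by blast
  then show "f \<in> borel_measurable borel" using sets_haar by simp
  show "integrable \<nu> f"
  proof (cases "p = \<infinity>")
    case True
    then have "esssup \<nu> (\<lambda>x. ennreal (norm (f x))) < \<infinity>"
      using f unfolding Lp_space_def by simp
    then obtain c where c: "esssup \<nu> (\<lambda>x. ennreal (norm (f x))) = ennreal c" "0 \<le> c"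
      by (cases "esssup \<nu> (\<lambda>x. ennreal (norm (f x)))") auto
    have "AE x in \<nu>. norm (f x) \<le> c"
      using esssup_AE[of "\<lambda>x. ennreal (norm (f x))" \<nu>] unfolding c(1)
      by eventually_elim (simp add: c(2))
    then show ?thesis using f' by (intro integrable_const_bound)
  next
    case False
    then have int: "integrable \<nu> (\<lambda>x. norm (f x) powr enn2real p)"
      using f unfolding Lp_space_def by simp
    have p1: "1 \<le> enn2real p"
      using p False enn2real_mono[of 1 p] by (simp add: less_top)
    show ?thesis
    proof (rule Bochner_Integration.integrable_bound[OF _ f'])
      show "integrable \<nu> (\<lambda>x. 1 + norm (f x) powr enn2real p)" using int by simp
      show "AE x in \<nu>. norm (f x) \<le> norm (1 + norm (f x) powr enn2real p)"
      proof (rule AE_I2)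
        fix x
        have "norm (f x) \<le> norm (f x) powr enn2real p" if "norm (f x) > 1"
          using powr_mono[OF p1, of "norm (f x)"] that by simp
        then have "norm (f x) \<le> 1 + norm (f x) powr enn2real p"
          using powr_ge_zero[of "norm (f x)" "enn2real p"] by linarith
        then show "norm (f x) \<le> norm (1 + norm (f x) powr enn2real p)" by simp
      qed
    qed
  qed
qed

end

context random_automorphism
begin

lemma weighted_average_Lp:
  fixes f g :: "'g \<Rightarrow> complex" and s :: "'w \<Rightarrow> complex"
  assumes p: "1 \<le> p" and f: "f \<in> Lp_space \<nu> p"
    and s: "s \<in> borel_measurable L" and s1: "\<And>u. norm (s u) \<le> 1"
    and g: "g \<in> borel_measurable borel" "AE x in \<nu>. g x = (\<integral>u. s u * f (A u x) \<partial>L)"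
  shows "g \<in> Lp_space \<nu> p" "Lp_norm \<nu> p g \<le> measure L (space L) * Lp_norm \<nu> p f"
proof -
  let ?m = "measure L (space L)"
  note fi = Lp_space_integrable[OF p f]
  have g': "g \<in> borel_measurable \<nu>" using g(1) sets_haar by simp
  have g'': "(\<lambda>x. ennreal (norm (g x))) \<in> borel_measurable \<nu>"
    using g(1) by measurable
  have "g \<in> Lp_space \<nu> p \<and> Lp_norm \<nu> p g \<le> ?m * Lp_norm \<nu> p f"
  proof (cases "p = \<infinity>")
    case True
    then have "esssup \<nu> (\<lambda>x. ennreal (norm (f x))) < \<infinity>"
      using f unfolding Lp_space_def by simp
    then obtain c where c: "esssup \<nu> (\<lambda>x. ennreal (norm (f x))) = ennreal c" "0 \<le> c"
      by (cases "esssup \<nu> (\<lambda>x. ennreal (norm (f x)))") auto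
    have "AE x in \<nu>. norm (f x) \<le> c"
      using esssup_AE[of "\<lambda>x. ennreal (norm (f x))" \<nu>] unfolding c(1)
      by eventually_elim (simp add: c(2))
    from weighted_average_bounded[of f c s, OF this s1] g(2)
    have "AE x in \<nu>. ennreal (norm (g x)) \<le> ennreal (?m * c)"
      by eventually_elim (simp add: ennreal_leI)
    then have le: "esssup \<nu> (\<lambda>x. ennreal (norm (g x))) \<le> ennreal (?m * c)"
      by (intro esssup_I g'')
    then have "esssup \<nu> (\<lambda>x. ennreal (norm (g x))) < \<infinity>"
      by (rule order_le_less_trans) simp
    moreover have "enn2real (esssup \<nu> (\<lambda>x. ennreal (norm (g x)))) \<le> ?m * c"
      using enn2real_mono[OF le] c(2) by simp
    ultimately show ?thesis
      using True g' c unfolding Lp_space_def Lp_norm_def by simp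
  next
    case False
    let ?p = "enn2real p"
    have int: "integrable \<nu> (\<lambda>x. norm (f x) powr ?p)"
      using f False unfolding Lp_space_def by simp
    have p1: "1 \<le> ?p"
      using p False enn2real_mono[of 1 p] by (simp add: less_top)
    note G = weighted_average_powr[OF p1 fi int s s1 g]
    have "(\<integral>x. norm (g x) powr ?p \<partial>\<nu>) powr (1 / ?p)
        \<le> (?m powr ?p * (\<integral>x. norm (f x) powr ?p \<partial>\<nu>)) powr (1 / ?p)"
      using p1 by (intro powr_mono2 G(2)) (auto intro: integral_nonneg_AE)
    also have "\<dots> = ?m * (\<integral>x. norm (f x) powr ?p \<partial>\<nu>) powr (1 / ?p)"
      using p1 by (simp add: powr_mult powr_powr integral_nonneg_AE)
    finally show ?thesis
      using False g' G(1) unfolding Lp_space_def Lp_norm_def by simp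
  qed
  then show "g \<in> Lp_space \<nu> p" "Lp_norm \<nu> p g \<le> ?m * Lp_norm \<nu> p f" by blast+
qed

text \<open>Averaging stays in the Hardy space because, by invariance of \<open>\<nu>\<close>, the coefficient of
  \<open>f \<circ> A u\<close> at \<open>\<gamma>\<close> is the coefficient of \<open>f\<close> at the character
  \<open>\<gamma> \<circ> inv (A u)\<close>.\<close>

lemma weighted_average_hardy:
  fixes f :: "'g \<Rightarrow> complex" and s :: "'w \<Rightarrow> complex"
  assumes p: "1 \<le> p" and f: "f \<in> hardy_space \<nu> p E"
    and s: "s \<in> borel_measurable L" and s1: "\<And>u. norm (s u) \<le> 1"
    and E: "AE u in L. inv_into characters (dual_aut (A u)) ` (characters - E) \<subseteq> characters - E"
  obtains g where "g \<in> hardy_space \<nu> p E" "AE x in \<nu>. g x = (\<integral>u. s u * f (A u x) \<partial>L)"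
proof -
  have fL: "f \<in> Lp_space \<nu> p" using f unfolding hardy_space_def by blast
  note fi = Lp_space_integrable[OF p fL]
  obtain g where g: "g \<in> borel_measurable borel" "AE x in \<nu>. g x = (\<integral>u. s u * f (A u x) \<partial>L)"
    "\<forall>k\<in>borel_measurable borel. (\<forall>x. norm (k x) \<le> 1) \<longrightarrow>
      (AE u in L. (\<integral>x. f (A u x) * k x \<partial>\<nu>) = 0) \<longrightarrow> (\<integral>x. g x * k x \<partial>\<nu>) = 0"
    by (rule weighted_average_version[OF fi s s1])
  have "fourier \<nu> g \<gamma> = 0" if \<gamma>: "\<gamma> \<in> characters - E" for \<gamma>
    unfolding fourier_def
  proof (rule g(3)[rule_format])
    have cont: "continuous_on UNIV (\<lambda>x. cnj (\<psi> x))" if "\<psi> \<in> characters" for \<psi> :: "'g \<Rightarrow> complex"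
      using that unfolding characters_def by (auto intro!: continuous_intros)
    show "(\<lambda>x. cnj (\<gamma> x)) \<in> borel_measurable borel"
      using cont \<gamma> by (intro borel_measurable_continuous_onI) blast
    show "norm (cnj (\<gamma> x)) \<le> 1" for x using \<gamma> unfolding characters_def by auto
    show "AE u in L. (\<integral>x. f (A u x) * cnj (\<gamma> x) \<partial>\<nu>) = 0"
      using E AE_space
    proof eventually_elim
      case (elim u)
      note T = A_automorphism[OF elim(2)]
      let ?\<psi> = "\<gamma> \<circ> inv (A u)"
      have \<psi>: "?\<psi> \<in> characters - E"
        using elim(1) \<gamma> inv_dual_aut[OF T, of \<gamma>] by (metis DiffD1 image_subset_iff)
      have "(\<lambda>y. f y * cnj (?\<psi> y)) \<in> borel_measurable borel"
        using cont[of ?\<psi>] \<psi>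
        by (intro borel_measurable_times fi(1) borel_measurable_continuous_onI) blast
      from integrable_automorphism(2)[OF T this]
      have "(\<integral>x. f (A u x) * cnj (\<gamma> x) \<partial>\<nu>) = fourier \<nu> f ?\<psi>"
        using top_automorphismD(1)[OF T] by (simp add: fourier_def bij_is_inj)
      then show ?case using f \<psi> unfolding hardy_space_def by simp
    qed
  qed
  then have "g \<in> hardy_space \<nu> p E"
    using weighted_average_Lp(1)[OF p fL s s1 g(1,2)] unfolding hardy_space_def by blast
  then show ?thesis using g(2) that by blast
qed

end

section \<open>The Hausdorff operator\<close>

text \<open>The kernel enters through the finite measure with density \<open>norm (\<Phi> u)\<close>.  It is
  carried by countably many sets of finite \<open>M\<close>-measure, so that \<open>A\<close> becomes
  separably valued almost everywhere.\<close>

lemma (in haar_group) random_automorphism_density: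
  fixes \<Phi> :: "'w \<Rightarrow> complex"
  assumes A: "aut_measurable M A" and \<Phi>: "integrable M \<Phi>"
  shows "random_automorphism \<nu> (density M (\<lambda>u. ennreal (norm (\<Phi> u)))) A"
proof -
  let ?L = "density M (\<lambda>u. ennreal (norm (\<Phi> u)))"
  note [measurable] = borel_measurable_integrable[OF \<Phi>]
  have "emeasure ?L (space ?L) = (\<integral>\<^sup>+u. ennreal (norm (\<Phi> u)) \<partial>M)"
    by (simp add: emeasure_density cong: nn_integral_cong)
  also have "\<dots> < \<infinity>" using \<Phi> unfolding integrable_iff_bounded by simp
  finally have "finite_measure ?L" by (intro finite_measureI) simp
  moreover have "A \<in> ?L \<rightarrow>\<^sub>M aut_borel"
    using A unfolding aut_measurable_def by simp
  moreover have "\<exists>D. countable D \<and> D \<subseteq> top_automorphisms \<and>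
      (AE u in ?L. \<exists>T\<in>D. \<forall>x. A u x - T x \<in> V)" if V: "open V" "0 \<in> V" for V
  proof -
    \<comment> \<open>Markov's inequality makes each of these sets finite, and together they carry \<open>\<Phi>\<close>.\<close>
    define S where "S j = {u \<in> space M. norm (\<Phi> u) \<ge> 1 / Suc j}" for j :: nat
    have sS: "S j \<in> sets M" for j unfolding S_def by measurable
    have "emeasure M (S j) < \<infinity>" for j
    proof -
      have "emeasure M (S j) \<le> ennreal (1 / (1 / Suc j) * (\<integral>u. norm (\<Phi> u) \<partial>M))"
        unfolding S_def using \<Phi> by (intro integral_Markov_inequality) auto
      also have "\<dots> < \<infinity>" by simp
      finally show ?thesis .
    qed
    then have "\<forall>j. \<exists>D. countable D \<and> D \<subseteq> top_automorphisms \<and>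
        (AE u in M. u \<in> S j \<longrightarrow> (\<exists>T\<in>D. \<forall>x. A u x - T x \<in> V))"
      using A sS V unfolding aut_measurable_def by blast
    then obtain D where "\<forall>j. countable (D j) \<and> D j \<subseteq> top_automorphisms \<and>
        (AE u in M. u \<in> S j \<longrightarrow> (\<exists>T\<in>D j. \<forall>x. A u x - T x \<in> V))"
      by (rule exE[OF choice])
    then have D: "\<And>j. countable (D j)" "\<And>j. D j \<subseteq> top_automorphisms"
      "\<And>j. AE u in M. u \<in> S j \<longrightarrow> (\<exists>T\<in>D j. \<forall>x. A u x - T x \<in> V)" by simp_all
    have "AE u in M. \<forall>j. u \<in> S j \<longrightarrow> (\<exists>T\<in>D j. \<forall>x. A u x - T x \<in> V)"
      unfolding AE_all_countable using D(3) by blast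
    then have "AE u in M. 0 < ennreal (norm (\<Phi> u)) \<longrightarrow> (\<exists>T\<in>(\<Union>j. D j). \<forall>x. A u x - T x \<in> V)"
      using AE_space
    proof eventually_elim
      case (elim u)
      show ?case
      proof
        assume "0 < ennreal (norm (\<Phi> u))"
        then obtain j where "inverse (of_nat (Suc j)) < norm (\<Phi> u)"
          using reals_Archimedean[of "norm (\<Phi> u)"] by auto
        then have "u \<in> S j" using elim(2) by (simp add: S_def inverse_eq_divide)
        then show "\<exists>T\<in>(\<Union>j. D j). \<forall>x. A u x - T x \<in> V" using elim(1) by blast
      qed
    qed
    then have "AE u in ?L. \<exists>T\<in>(\<Union>j. D j). \<forall>x. A u x - T x \<in> V"
      by (subst AE_density) simp_all
    then show ?thesis using D(1,2) by (intro exI[of _ "\<Union>j. D j"]) auto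
  qed
  ultimately show ?thesis
    by (intro random_automorphism.intro random_automorphism_axioms.intro haar_group_axioms)
qed

theorem theorem2:
  fixes \<nu> :: "'g::{topological_ab_group_add, t2_space} measure"
    and E :: "('g \<Rightarrow> complex) set"
    and M :: "'w measure"
    and A :: "'w \<Rightarrow> 'g \<Rightarrow> 'g"
    and \<Phi> :: "'w \<Rightarrow> complex"
    and p :: ennreal
  assumes "compact (UNIV :: 'g set)"
    and "normalized_haar \<nu>"
    and "E \<subseteq> characters" and "E \<noteq> {}"
    and "aut_measurable M A"
    and "locally_integrable M \<Phi>"
    and "AE u in M. inv_into characters (dual_aut (A u)) ` (characters - E) \<subseteq> characters - E"
    and "1 \<le> p"
    and "integrable M \<Phi>"
  shows "hausdorff_bounded_on M \<Phi> A \<nu> (hardy_space \<nu> p E) (Lp_norm \<nu> p) \<and>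
         op_norm_on \<nu> (hardy_space \<nu> p E) (Lp_norm \<nu> p) (hausdorff_op M \<Phi> A)
           \<le> (\<integral>u. norm (\<Phi> u) \<partial>M)"
proof -
  interpret haar_group \<nu> by unfold_locales (fact assms(1,2))+
  define L where "L = density M (\<lambda>u. ennreal (norm (\<Phi> u)))"
  interpret random_automorphism \<nu> L A
    unfolding L_def by (rule random_automorphism_density[OF assms(5,9)])
  note \<Phi> [measurable] = borel_measurable_integrable[OF assms(9)]
  define s where "s u = sgn (\<Phi> u)" for u
  let ?Y = "hardy_space \<nu> p E" and ?N = "Lp_norm \<nu> p" and ?H = "hausdorff_op M \<Phi> A"
  let ?C = "\<integral>u. norm (\<Phi> u) \<partial>M"
  have sL: "s \<in> borel_measurable L" unfolding s_def L_def by measurable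
  have s1: "norm (s u) \<le> 1" for u by (simp add: s_def norm_sgn)
  have mass: "measure L (space L) = ?C"
  proof -
    have "emeasure L (space L) = (\<integral>\<^sup>+u. ennreal (norm (\<Phi> u)) \<partial>M)"
      unfolding L_def by (simp add: emeasure_density cong: nn_integral_cong)
    also have "\<dots> = ennreal ?C"
      using assms(9) by (intro nn_integral_eq_integral) auto
    finally have "emeasure L (space L) = ennreal ?C" .
    then show ?thesis by (simp add: measure_def integral_nonneg_AE)
  qed
  have E: "AE u in L. inv_into characters (dual_aut (A u)) ` (characters - E) \<subseteq> characters - E"
    unfolding L_def using assms(7) by (subst AE_density) auto
  have polar: "norm (\<Phi> u) *\<^sub>R (s u * z) = \<Phi> u * z" for u z
    unfolding s_def sgn_div_norm by (cases "\<Phi> u = 0") (simp_all add: scaleR_conv_of_real)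
  have Am: "(\<lambda>u. f (A u x)) \<in> borel_measurable M" if "f \<in> borel_measurable borel"
    for f :: "'g \<Rightarrow> complex" and x
    using measurable_compose[OF A_point_measurable that] unfolding L_def by simp
  have sM [measurable]: "s \<in> borel_measurable M" unfolding s_def by measurable
  have HL: "?H f x = (\<integral>u. s u * f (A u x) \<partial>L)" if f: "f \<in> borel_measurable borel" for f x
  proof -
    note [measurable] = Am[OF f]
    show ?thesis unfolding L_def hausdorff_op_def by (subst integral_density) (auto simp: polar)
  qed
  have YL: "f \<in> Lp_space \<nu> p" if "f \<in> ?Y" for f using that unfolding hardy_space_def by blast
  note Yb = Lp_space_integrable(1)[OF assms(8) YL]
  have exist: "AE x in \<nu>. integrable M (\<lambda>u. \<Phi> u * f (A u x))" if f: "f \<in> ?Y" for f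
  proof -
    note fi = Lp_space_integrable[OF assms(8) YL[OF f]]
    show ?thesis using AE_integrable_random_automorphism[OF fi]
    proof eventually_elim
      case (elim x)
      note [measurable] = Am[OF fi(1), of x]
      have "integrable L (\<lambda>u. s u * f (A u x))"
      proof (rule Bochner_Integration.integrable_bound[OF elim])
        show "(\<lambda>u. s u * f (A u x)) \<in> borel_measurable L" unfolding L_def by measurable
        show "AE u in L. norm (s u * f (A u x)) \<le> norm (f (A u x))"
          using mult_right_mono[OF s1] by (intro AE_I2) (force simp: norm_mult)
      qed
      then show ?case unfolding L_def by (subst (asm) integrable_density) (auto simp: polar)
    qed
  qed
  have image: "\<exists>g\<in>?Y. AE x in \<nu>. g x = ?H f x" if f: "f \<in> ?Y" for f
  proof -
    obtain g where "g \<in> ?Y" "AE x in \<nu>. g x = (\<integral>u. s u * f (A u x) \<partial>L)"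
      by (rule weighted_average_hardy[OF assms(8) f sL s1 E])
    then show ?thesis using HL[OF Yb[OF f]] by auto
  qed
  have bound: "?N g \<le> ?C * ?N f" if f: "f \<in> ?Y" and g: "g \<in> ?Y" "AE x in \<nu>. g x = ?H f x" for f g
    using weighted_average_Lp(2)[OF assms(8) YL[OF f] sL s1 Yb[OF g(1)]] g(2) HL[OF Yb[OF f]] mass
    by simp
  have cong: "AE x in \<nu>. ?H f x = ?H h x"
    if f: "f \<in> ?Y" and h: "h \<in> ?Y" and eq: "AE x in \<nu>. f x = h x" for f h
    using AE_random_automorphism[OF eq]
  proof eventually_elim
    case (elim x)
    note [measurable] = Am[OF Yb[OF f], of x] Am[OF Yb[OF h], of x]
    have "AE u in L. s u * f (A u x) = s u * h (A u x)"
      using elim by eventually_elim simp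
    then show ?case unfolding HL[OF Yb[OF f]] HL[OF Yb[OF h]]
      by (intro integral_cong_AE) (simp_all add: L_def)
  qed
  have add: "AE x in \<nu>. ?H (\<lambda>y. f y + h y) x = ?H f x + ?H h x" if "f \<in> ?Y" "h \<in> ?Y" for f h
    using exist[OF that(1)] exist[OF that(2)]
    by eventually_elim (simp add: hausdorff_op_def distrib_left)
  have scale: "?H (\<lambda>y. c * f y) x = c * ?H f x" for c f x
    by (simp add: hausdorff_op_def mult.left_commute)
  have "bounded_on \<nu> ?Y ?N ?H"
    unfolding bounded_on_def using image cong add scale bound by blast
  then have "hausdorff_bounded_on M \<Phi> A \<nu> ?Y ?N"
    unfolding hausdorff_bounded_on_def using exist by blast
  moreover have "op_norm_on \<nu> ?Y ?N ?H \<le> ?C"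
    unfolding op_norm_on_def
  proof (rule cInf_lower)
    show "?C \<in> {C. 0 \<le> C \<and> (\<forall>f\<in>?Y. \<forall>g\<in>?Y. (AE x in \<nu>. g x = ?H f x) \<longrightarrow> ?N g \<le> C * ?N f)}"
      using bound by (auto intro: integral_nonneg_AE)
  qed (auto intro: bdd_belowI[of _ 0])
  ultimately show ?thesis by blast
qed

end
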